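(* Let $\kappa$ be an uncountable regular cardinal. Then every regular space $X$ satisfying $$\Delta(X) \ge \kappa \ge \widehat{\operatorname{e}}(X)$$ is $\omega$-resolvable. Consequently, every regular space $X$ that satisfies $\Delta(X) > \operatorname{e}(X)$ is $\omega$-resolvable.
   Context: Regular spaces are understood to be $T_1$ (so regular implies Hausdorff). For a cardinal $\lambda$, a topological space $X$ is $\lambda$-resolvable if it contains $\lambda$ many pairwise disjoint dense subsets. The dispersion character of $X$ is $\Delta(X)=\min\{|G| : G \text{ is a non-empty open subset of } X\}$. The extent $\operatorname{e}(X)$ is the supremum of the sizes of all closed-and-discrete subsets of $X$. $\widehat{\operatorname{e}}(X)$ is the smallest cardinal $\lambda$ such that $X$ has no closed-and-discrete subset of size $\lambda$. *)

theory Defs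
  imports "HOL-Analysis.Analysis"
begin

no_notation Set_Algebras.elt_set_eq (infix "=o" 50)
unbundle cardinal_syntax

text \<open>
  Cardinals are rendered as in the library: as relations \<open>r\<close> with \<open>Card_order r\<close>, compared by
  \<open>\<le>o\<close>, \<open><o\<close>, \<open>=o\<close>, also across different types. The least size of a set of type \<open>'a set\<close>
  with a given property is unspecified if no set has the property.
\<close>

definition least_card :: "('a set \<Rightarrow> bool) \<Rightarrow> 'a rel" where
  "least_card P = |SOME A. P A \<and> (\<forall>B. P B \<longrightarrow> |A| \<le>o |B| )|"

definition dense_in :: "'a topology \<Rightarrow> 'a set \<Rightarrow> bool" where
  "dense_in X D \<longleftrightarrow> D \<subseteq> topspace X \<and> X closure_of D = topspace X"

definition resolvable :: "'k rel \<Rightarrow> 'a topology \<Rightarrow> bool" where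
  "resolvable \<mu> X \<longleftrightarrow> (\<exists>\<D>. |\<D>| =o \<mu> \<and> disjoint \<D> \<and> (\<forall>D\<in>\<D>. dense_in X D))"

text \<open>The dispersion character is meaningful for nonempty spaces only.\<close>

definition dispersion_character :: "'a topology \<Rightarrow> 'a rel" where
  "dispersion_character X = least_card (\<lambda>G. openin X G \<and> G \<noteq> {})"

definition closed_discrete :: "'a topology \<Rightarrow> 'a set \<Rightarrow> bool" where
  "closed_discrete X C \<longleftrightarrow> closedin X C \<and> subtopology X C = discrete_topology C"

text \<open>
  The supremum is the least upper bound; as \<open>|topspace X|\<close> is an upper bound, it is the size of a
  set of type \<open>'a set\<close>.
\<close>

definition extent :: "'a topology \<Rightarrow> 'a rel" where
  "extent X = least_card (\<lambda>A. \<forall>C. closed_discrete X C \<longrightarrow> |C| \<le>o |A| )"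

text \<open>
  This cardinal can exceed the size of \<open>'a\<close> (for a discrete space it is the successor of
  \<open>|topspace X|\<close>) but not that of \<open>'a set\<close>, hence the type. The lemmas \<open>extent_le_iff\<close> and
  \<open>extent_hat_le_iff\<close> below compare with cardinals on arbitrary types, so the choice of the
  types is immaterial.
\<close>

definition extent_hat :: "'a topology \<Rightarrow> 'a set rel" where
  "extent_hat X = least_card (\<lambda>L. \<not> (\<exists>C. closed_discrete X C \<and> |C| =o |L| ))"

lemma least_card_witness:
  assumes "P A0"
  shows "\<exists>A. least_card P = |A| \<and> P A \<and> (\<forall>B. P B \<longrightarrow> |A| \<le>o |B| )"
proof -
  let ?R = "{ |A| | A. P A}"
  have "\<exists>r\<in>?R. \<forall>r'\<in>?R. r \<le>o r'"
    by (rule exists_minim_Well_order) (use assms in \<open>auto simp: card_of_Well_order\<close>)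
  then have "\<exists>A. P A \<and> (\<forall>B. P B \<longrightarrow> |A| \<le>o |B| )"
    by blast
  from someI_ex[OF this] show ?thesis
    unfolding least_card_def by blast
qed

lemma ex_subset_card_of:
  assumes "Card_order r" "r \<le>o |A|"
  obtains B where "B \<subseteq> A" "|B| =o r"
proof -
  have r: "|Field r| =o r"
    using assms(1) by (rule card_of_Field_ordIso)
  then have "|Field r| \<le>o |A|"
    using assms(2) ordIso_ordLeq_trans by blast
  then obtain B where B: "B \<subseteq> A" "|Field r| =o |B|"
    unfolding internalize_card_of_ordLeq2[of "Field r" A] by blast
  show thesis
    by (rule that[OF B(1) ordIso_transitive[OF ordIso_symmetric[OF B(2)] r]])
qed

lemma closed_discrete_subset:
  assumes "closed_discrete X C" "B \<subseteq> C"
  shows "closed_discrete X B"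
proof -
  have "closedin (subtopology X C) B"
    using assms by (simp add: closed_discrete_def)
  then have "closedin X B"
    using assms(1) closed_discrete_def closedin_trans_full by blast
  moreover have "subtopology X B = subtopology (subtopology X C) B"
    using assms(2) by (simp add: subtopology_subtopology inf.absorb2)
  ultimately show ?thesis
    using assms by (simp add: closed_discrete_def subtopology_discrete_topology inf.absorb2)
qed

lemma dispersion_character_ge_iff:
  assumes "topspace X \<noteq> {}"
  shows "r \<le>o dispersion_character X \<longleftrightarrow> (\<forall>G. openin X G \<and> G \<noteq> {} \<longrightarrow> r \<le>o |G| )"
proof -
  have "openin X (topspace X) \<and> topspace X \<noteq> {}"
    using assms by simp
  then obtain G where G: "dispersion_character X = |G|" "openin X G \<and> G \<noteq> {}"
    and least: "\<And>H. openin X H \<and> H \<noteq> {} \<Longrightarrow> |G| \<le>o |H|"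
    unfolding dispersion_character_def
    using least_card_witness[of "\<lambda>G. openin X G \<and> G \<noteq> {}"] by meson
  show ?thesis
    unfolding G(1) using G(2) least ordLeq_transitive by blast
qed

lemma extent_le_iff:
  assumes "Card_order r"
  shows "extent (X :: 'a topology) \<le>o r \<longleftrightarrow> (\<forall>C. closed_discrete X C \<longrightarrow> |C| \<le>o r)"
proof -
  have wo: "Well_order r"
    using assms card_order_on_well_order_on by blast
  have "\<forall>C. closed_discrete X C \<longrightarrow> |C| \<le>o |topspace X|"
    by (simp add: closed_discrete_def card_of_mono1 closedin_subset)
  from least_card_witness[of "\<lambda>A. \<forall>C. closed_discrete X C \<longrightarrow> |C| \<le>o |A|", OF this, folded extent_def]
  obtain A where A': "extent X = |A| \<and> (\<forall>C. closed_discrete X C \<longrightarrow> |C| \<le>o |A| ) \<and>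
    (\<forall>B :: 'a set. (\<forall>C. closed_discrete X C \<longrightarrow> |C| \<le>o |B| ) \<longrightarrow> |A| \<le>o |B| )" ..
  have A: "extent X = |A|" "\<And>C. closed_discrete X C \<Longrightarrow> |C| \<le>o |A|"
    using A' by simp_all
  have least: "|A| \<le>o |B|" if "\<forall>C. closed_discrete X C \<longrightarrow> |C| \<le>o |B|" for B :: "'a set"
    using A' that by simp
  have "|A| \<le>o r" if ub: "\<forall>C. closed_discrete X C \<longrightarrow> |C| \<le>o r"
  proof (rule ccontr)
    assume *: "\<not> |A| \<le>o r"
    then have "r \<le>o |A|"
      using ordLeq_total[OF wo card_of_Well_order] by blast
    then obtain B where B: "|B| =o r" and "B \<subseteq> A"
      by (rule ex_subset_card_of[OF assms])
    have "|A| \<le>o |B|"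
      using ub ordLeq_ordIso_trans[OF _ ordIso_symmetric[OF B]] by (intro least) blast
    then show False
      using * ordLeq_ordIso_trans[OF _ B] by blast
  qed
  then show ?thesis
    unfolding A(1) using A(2) ordLeq_transitive by blast
qed

lemma extent_hat_le_iff:
  assumes "Card_order r"
  shows "extent_hat (X :: 'a topology) \<le>o r \<longleftrightarrow> (\<forall>C. closed_discrete X C \<longrightarrow> |C| <o r)"
proof -
  have wo: "Well_order r"
    using assms card_order_on_well_order_on by blast
  have "\<not> (\<exists>C. closed_discrete X C \<and> |C| =o |Pow (topspace X)| )"
  proof
    assume "\<exists>C. closed_discrete X C \<and> |C| =o |Pow (topspace X)|"
    then obtain C where C: "closedin X C" "|C| =o |Pow (topspace X)|"
      by (auto simp: closed_discrete_def)
    then have "|C| <o |C|"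
      using ordLess_ordIso_trans[OF ordLeq_ordLess_trans[OF card_of_mono1 card_of_Pow]
          ordIso_symmetric, OF closedin_subset] by blast
    then show False
      using ordLess_irreflexive by blast
  qed
  from least_card_witness[of "\<lambda>L. \<not> (\<exists>C. closed_discrete X C \<and> |C| =o |L| )", OF this,
      folded extent_hat_def]
  obtain L where L': "extent_hat X = |L| \<and> \<not> (\<exists>C. closed_discrete X C \<and> |C| =o |L| ) \<and>
    (\<forall>B :: 'a set set. \<not> (\<exists>C. closed_discrete X C \<and> |C| =o |B| ) \<longrightarrow> |L| \<le>o |B| )" ..
  have L: "extent_hat X = |L|" "\<not> (\<exists>C. closed_discrete X C \<and> |C| =o |L| )"
    using L' by simp_all
  have least: "|L| \<le>o |B|" if "\<not> (\<exists>C. closed_discrete X C \<and> |C| =o |B| )" for B :: "'a set set"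
    using L' that by simp
  show ?thesis
    unfolding L(1)
  proof safe
    fix C assume le: "|L| \<le>o r" and C: "closed_discrete X C"
    show "|C| <o r"
    proof (rule ccontr)
      assume "\<not> |C| <o r"
      then have "r \<le>o |C|"
        using ordLess_or_ordLeq[OF card_of_Well_order wo] by blast
      then have "|L| \<le>o |C|"
        using le ordLeq_transitive by blast
      then obtain B where "B \<subseteq> C" "|B| =o |L|"
        using card_of_Card_order ex_subset_card_of[of "|L|" C] by blast
      then show False
        using C L(2) closed_discrete_subset by blast
    qed
  next
    assume lt: "\<forall>C. closed_discrete X C \<longrightarrow> |C| <o r"
    show "|L| \<le>o r"
    proof (rule ccontr)
      assume *: "\<not> |L| \<le>o r"
      then have "r \<le>o |L|"
        using ordLeq_total[OF wo card_of_Well_order] by blast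
      then obtain B where B: "|B| =o r" and "B \<subseteq> L"
        by (rule ex_subset_card_of[OF assms])
      have "\<not> (\<exists>C. closed_discrete X C \<and> |C| =o |B| )"
        using lt not_ordLess_ordIso ordIso_transitive[OF _ B] by blast
      then have "|L| \<le>o |B|"
        by (rule least)
      then show False
        using * ordLeq_ordIso_trans[OF _ B] by blast
    qed
  qed
qed

end

theory Submission
  imports Defs
begin

text \<open>
  Call a set small, moderate or large if its size is less than, at most, or at least \<open>\<kappa>\<close>.
  By gluing, it suffices to find a nonempty \<open>\<omega>\<close>-resolvable subspace in every subspace that
  shares the two hypotheses locally. The combinatorial source of resolvability is a moderate
  set \<open>Z\<close> that contains, in every open set meeting it, a large set all of whose large
  subsets accumulate (with large intersections) at points of a moderate set \<open>P\<close>: a tree of almost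
  disjoint large sets with \<open>\<kappa>\<close>-indexings that decrease along branches yields disjoint
  sets accumulating at enough points of \<open>P\<close>.

  If there is no \<open>\<omega>\<close>-resolvable subspace, then some subspace is a finite union of disjoint dense
  sets, each of which is locally left separated since each of its subsets is locally trivial.
  Take the least possible number of such sets. Then the union of a proper subfamily violates
  the local limit condition somewhere, so it contains large sets whose limit points all lie in
  the remaining sets. Such a set of limit points is either small or left separated, and both
  cases produce the sets that the combinatorial source requires.
\<close>

section \<open>Small, moderate and large sets\<close>

text \<open>The obstacle is disjointness: a point of accumulation offers many large sets, but those
  attached to different points overlap. Almost disjointness repairs this when at most \<kappa> sets
  are involved, as each then loses only its overlaps with fewer than \<kappa> earlier ones. The tree
  may have far more than \<kappa> nodes, so it is thinned through the moderate set \<open>P\<close>: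
  if a node has more than \<kappa> relevant children, a single point of \<open>P\<close> serves more
  than \<kappa> of them, and countably many are kept for that point. Regularity and uncountability
  of \<kappa> keep the total loss over all finite levels small. A union of fewer dense pieces
  inherits density and irresolvability for free, so minimality applies to it as soon as its open
  parts are known to be large. This largeness is itself obtained from minimality, applied to the
  single omitted piece. Left separation comes from irresolvability: a greedily chosen left separated
  subset is dense, hence contains a nonempty relatively open part.\<close>

lemma wf_rec_predicate:
  assumes "wf R"
  obtains P where "\<And>x. P x \<longleftrightarrow> F x {y. (y, x) \<in> R \<and> P y}"
proof
  let ?P = "wfrec R (\<lambda>P x. F x {y. (y, x) \<in> R \<and> P y})"
  show "?P x \<longleftrightarrow> F x {y. (y, x) \<in> R \<and> ?P y}" for x
  proof -
    have "{y. (y, x) \<in> R \<and> cut ?P R x y} = {y. (y, x) \<in> R \<and> ?P y}"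
      by (auto simp: cut_apply)
    then show ?thesis
      by (subst wfrec[OF assms]) simp
  qed
qed

locale regular_cardinal =
  fixes \<kappa> :: "'k rel"
  assumes card_order: "Card_order \<kappa>"
    and uncountable: "natLeq <o \<kappa>"
    and regular: "regularCard \<kappa>"
begin

definition small :: "'b set \<Rightarrow> bool" where
  "small A \<longleftrightarrow> |A| <o \<kappa>"

definition moderate :: "'b set \<Rightarrow> bool" where
  "moderate A \<longleftrightarrow> |A| \<le>o \<kappa>"

abbreviation large :: "'b set \<Rightarrow> bool" where
  "large A \<equiv> \<not> small A"

lemma well_order: "Well_order \<kappa>"
  using card_order card_order_on_well_order_on by blast

lemma wf_strict: "wf (\<kappa> - Id)"
  using well_order well_order_on_def by blast

lemma Cinfinite: "Cinfinite \<kappa>"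
  using uncountable card_order natLeq_ordLeq_cinfinite
  by (meson cinfinite_mono natLeq_cinfinite ordLess_imp_ordLeq)

lemma infinite_Field: "infinite (Field \<kappa>)"
  using Cinfinite cinfinite_def by auto

lemma large_iff: "large A \<longleftrightarrow> \<kappa> \<le>o |A|"
  unfolding small_def using well_order card_of_Well_order not_ordLess_iff_ordLeq by blast

lemma small_imp_moderate: "small A \<Longrightarrow> moderate A"
  by (simp add: small_def moderate_def ordLess_imp_ordLeq)

lemma countable_imp_small:
  assumes "countable A"
  shows "small A"
proof -
  have "|A| \<le>o |UNIV :: nat set|"
    using assms card_of_ordLeq countable_def by blast
  then show ?thesis
    unfolding small_def using uncountable card_of_nat ordLeq_ordIso_trans ordLeq_ordLess_trans by blast
qed

lemma small_mono: "small B \<Longrightarrow> A \<subseteq> B \<Longrightarrow> small A"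
  unfolding small_def using card_of_mono1 ordLeq_ordLess_trans by blast

lemma moderate_mono: "moderate B \<Longrightarrow> A \<subseteq> B \<Longrightarrow> moderate A"
  unfolding moderate_def using card_of_mono1 ordLeq_transitive by blast

lemma small_image: "small A \<Longrightarrow> small (f ` A)"
  unfolding small_def using card_of_image ordLeq_ordLess_trans by blast

lemma large_inj_image: "inj_on f A \<Longrightarrow> large A \<Longrightarrow> large (f ` A)"
  by (metis inv_into_image_cancel small_image subset_refl)

text \<open>The regularity of \<kappa> enters here.\<close>

lemma small_UN: "small I \<Longrightarrow> (\<And>i. i \<in> I \<Longrightarrow> small (A i)) \<Longrightarrow> small (\<Union>i\<in>I. A i)"
  unfolding small_def
  using card_of_UNION_ordLess_infinite_Field_regularCard[OF regular Cinfinite] by blast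

lemma small_Un: "small A \<Longrightarrow> small B \<Longrightarrow> small (A \<union> B)"
  using small_UN[of "{True, False}" "\<lambda>b. if b then A else B"]
  by (simp add: countable_imp_small Un_commute)

lemma large_Diff: "large A \<Longrightarrow> small B \<Longrightarrow> large (A - B)"
  using small_Un[of "A - B" B] small_mono[of "A - B \<union> B" A] by blast

lemma moderate_UN: "moderate I \<Longrightarrow> (\<And>i. i \<in> I \<Longrightarrow> moderate (A i)) \<Longrightarrow> moderate (\<Union>i\<in>I. A i)"
  unfolding moderate_def
  using card_of_UNION_ordLeq_infinite_Field[OF infinite_Field card_order] by blast

lemma moderate_Un: "moderate A \<Longrightarrow> moderate B \<Longrightarrow> moderate (A \<union> B)"
  using moderate_UN[of "{True, False}" "\<lambda>b. if b then A else B"]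
  by (simp add: countable_imp_small small_imp_moderate Un_commute)

lemma moderate_Times: "moderate A \<Longrightarrow> moderate B \<Longrightarrow> moderate (A \<times> B)"
  unfolding moderate_def
  using card_of_Times_ordLeq_infinite_Field[OF infinite_Field _ _ card_order] by blast

lemma moderate_iff_inj: "moderate A \<longleftrightarrow> (\<exists>g. inj_on g A \<and> g ` A \<subseteq> Field \<kappa>)"
proof -
  have "|Field \<kappa>| =o \<kappa>"
    by (rule card_of_Field_ordIso[OF card_order])
  then have "moderate A \<longleftrightarrow> |A| \<le>o |Field \<kappa>|"
    unfolding moderate_def using ordLeq_ordIso_trans ordIso_symmetric by blast
  then show ?thesis
    by (simp add: card_of_ordLeq)
qed

lemma moderate_large_bij:
  assumes "moderate A" "large A"
  obtains g where "bij_betw g (Field \<kappa>) A"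
proof -
  have "|A| =o |Field \<kappa>|"
    using assms card_of_Field_ordIso[OF card_order] ordIso_symmetric ordIso_transitive
    unfolding moderate_def large_iff by (metis ordIso_iff_ordLeq)
  then show thesis
    using that card_of_ordIso ordIso_symmetric by metis
qed

lemma large_Field: "large (Field \<kappa>)"
  using card_of_Field_ordIso[OF card_order] large_iff ordIso_iff_ordLeq by blast

lemma large_imp_moderate_large_subset:
  assumes "large A"
  obtains B where "B \<subseteq> A" "moderate B" "large B"
proof -
  have "\<kappa> \<le>o |A|"
    using assms large_iff by blast
  then obtain B where "B \<subseteq> A" "|B| =o \<kappa>"
    using ex_subset_card_of[OF card_order] by blast
  then show thesis
    using that ordIso_iff_ordLeq unfolding moderate_def large_iff by blast
qed

lemma small_predecessors:
  assumes "inj_on g A" "g ` A \<subseteq> Field \<kappa>" "a \<in> A"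
  shows "small {b \<in> A. (g b, g a) \<in> \<kappa> - Id}"
proof -
  have "small (underS \<kappa> (g a))"
    unfolding small_def using assms card_of_underS[OF card_order] by blast
  moreover have "{b \<in> A. (g b, g a) \<in> \<kappa> - Id} \<subseteq> inv_into A g ` underS \<kappa> (g a)"
    using assms by (auto simp: underS_def image_iff) (metis inv_into_f_f)
  ultimately show ?thesis
    using small_image small_mono by blast
qed

lemma trichotomy:
  assumes "i \<in> Field \<kappa>" "j \<in> Field \<kappa>"
  shows "i = j \<or> (i, j) \<in> \<kappa> - Id \<or> (j, i) \<in> \<kappa> - Id"
  using well_order assms unfolding well_order_on_def linear_order_on_def total_on_def by blast

lemma large_nonempty: "large A \<Longrightarrow> A \<noteq> {}"
  using countable_imp_small by auto

text \<open>Recursion along an indexing of \<open>I\<close> by ordinals below \<kappa>: at each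
  stage fewer than \<kappa> values are taken, so \<open>C i\<close> still offers a new one.\<close>

lemma injective_choice:
  assumes I: "moderate I" and C: "\<forall>i\<in>I. \<not> moderate (C i)"
  obtains f where "inj_on f I" "\<forall>i\<in>I. f i \<in> C i"
proof -
  obtain g where g: "inj_on g I" "g ` I \<subseteq> Field \<kappa>"
    using I unfolding moderate_iff_inj by (elim exE conjE)
  define R where "R = inv_image (\<kappa> - Id) g"
  have wf: "wf R"
    unfolding R_def using wf_strict by (rule wf_inv_image)
  define f where "f = wfrec R (\<lambda>f i. SOME b. b \<in> C i \<and> b \<notin> f ` {j \<in> I. (j, i) \<in> R})"
  have f_eq: "f i = (SOME b. b \<in> C i \<and> b \<notin> f ` {j \<in> I. (j, i) \<in> R})" for i
  proof -
    have "cut f R i ` {j \<in> I. (j, i) \<in> R} = f ` {j \<in> I. (j, i) \<in> R}"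
      by (auto simp: cut_apply image_iff)
    then show ?thesis
      unfolding f_def by (subst wfrec[OF wf]) simp
  qed
  have f: "f i \<in> C i \<and> f i \<notin> f ` {j \<in> I. (j, i) \<in> R}" if "i \<in> I" for i
  proof -
    have "small {j \<in> I. (j, i) \<in> R}"
      using small_predecessors[OF g that] by (simp add: R_def)
    then have "moderate (f ` {j \<in> I. (j, i) \<in> R})"
      by (intro small_imp_moderate small_image)
    then have "\<not> C i \<subseteq> f ` {j \<in> I. (j, i) \<in> R}"
      using bspec[OF C that] moderate_mono by blast
    then have "\<exists>b. b \<in> C i \<and> b \<notin> f ` {j \<in> I. (j, i) \<in> R}"
      by blast
    from someI_ex[OF this] show ?thesis
      unfolding f_eq[of i] .
  qed
  have "inj_on f I"
  proof (rule inj_onI, rule ccontr)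
    fix i j assume ij: "i \<in> I" "j \<in> I" "f i = f j" "i \<noteq> j"
    then have "g i \<noteq> g j"
      using g inj_on_def by metis
    then have "(i, j) \<in> R \<or> (j, i) \<in> R"
      unfolding R_def using trichotomy[of "g i" "g j"] g ij by auto
    then show False
      using f[OF ij(1)] f[OF ij(2)] ij by (metis (mono_tags, lifting) image_eqI mem_Collect_eq)
  qed
  then show thesis
    using that[of f] f by simp
qed

section \<open>Trees of almost disjoint sets\<close>

definition almost_disjoint :: "'b set set \<Rightarrow> bool" where
  "almost_disjoint \<A> \<longleftrightarrow> (\<forall>A\<in>\<A>. \<forall>B\<in>\<A>. A \<noteq> B \<longrightarrow> small (A \<inter> B))"

lemma almost_disjointD: "almost_disjoint \<A> \<Longrightarrow> A \<in> \<A> \<Longrightarrow> B \<in> \<A> \<Longrightarrow> large (A \<inter> B) \<Longrightarrow> A = B"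
  unfolding almost_disjoint_def by blast

lemma almost_disjoint_large_subset:
  assumes "almost_disjoint \<A>" "A \<in> \<A>" "B \<in> \<A>" "large C" "C \<subseteq> A" "C \<subseteq> B"
  shows "A = B"
  using assms almost_disjointD small_mono by (metis le_inf_iff)

text \<open>
  Indexing one half of \<open>T\<close> by the smaller indices of the other half makes the new indices
  strictly smaller.
\<close>

lemma regressive_index:
  assumes "large T" and e: "inj_on e T" "e ` T \<subseteq> Field \<kappa>"
  obtains B e' where "B \<subseteq> T" "large B" "inj_on e' B" "e' ` B \<subseteq> Field \<kappa>"
    "\<And>x. x \<in> B \<Longrightarrow> (e' x, e x) \<in> \<kappa> - Id"
proof -
  have "infinite T"
    using assms(1) countable_imp_small countable_finite by blast
  then have "|T <+> T| =o |T|"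
    using card_of_Plus_infinite[of T T] card_of_refl ordIso_imp_ordLeq by blast
  then obtain h where h: "bij_betw h (T <+> T) T"
    using card_of_ordIso by blast
  then have inj: "inj_on h (T <+> T)"
    by (simp add: bij_betw_def)
  have hT: "h (Inl x) \<in> T" "h (Inr x) \<in> T" if "x \<in> T" for x
    using h that bij_betwE by blast+
  define asc where "asc x \<longleftrightarrow> (e (h (Inl x)), e (h (Inr x))) \<in> \<kappa>" for x
  define hi where "hi x = h (if asc x then Inr x else Inl x)" for x
  define lo where "lo x = h (if asc x then Inl x else Inr x)" for x
  have hi: "inj_on hi T" and lo: "inj_on lo T"
    using inj by (auto simp: inj_on_def hi_def lo_def split: if_splits)
  have hl: "hi x \<in> T" "lo x \<in> T" if "x \<in> T" for x
    using hT[OF that] by (auto simp: hi_def lo_def)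
  have less: "(e (lo x), e (hi x)) \<in> \<kappa> - Id" if "x \<in> T" for x
  proof -
    have "h (Inl x) \<noteq> h (Inr x)"
      using inj that by (metis InlI InrI Inl_Inr_False inj_onD)
    then have "e (h (Inl x)) \<noteq> e (h (Inr x))"
      using e(1) hT[OF that] by (meson inj_onD)
    then show ?thesis
      using trichotomy[of "e (h (Inl x))" "e (h (Inr x))"] e(2) hT[OF that]
      by (auto simp: hi_def lo_def asc_def)
  qed
  define e' where "e' y = e (lo (inv_into T hi y))" for y
  have e'_hi: "e' (hi x) = e (lo x)" if "x \<in> T" for x
    using that hi by (simp add: e'_def)
  show thesis
  proof (rule that[of "hi ` T" e'])
    show "large (hi ` T)"
      using large_inj_image[OF hi assms(1)] .
    show "inj_on e' (hi ` T)"
    proof (rule inj_onI)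
      fix y z assume "y \<in> hi ` T" "z \<in> hi ` T" and eq: "e' y = e' z"
      then obtain u v where uv: "y = hi u" "z = hi v" "u \<in> T" "v \<in> T"
        by blast
      then have "e (lo u) = e (lo v)"
        using eq e'_hi by simp
      then have "u = v"
        using e(1) lo uv hl by (metis inj_onD)
      then show "y = z"
        using uv by simp
    qed
    show "e' ` hi ` T \<subseteq> Field \<kappa>"
      using e hl by (auto simp: e'_hi)
  qed (use hl less e'_hi in auto)
qed

text \<open>Zorn's lemma: a large \<open>B\<close> in \<open>\<N>\<close> that met every member in a
  small set could be added.\<close>

lemma maximal_almost_disjoint:
  obtains \<A> where "\<A> \<subseteq> \<N>" "almost_disjoint \<A>"
    "\<And>B. B \<in> \<N> \<Longrightarrow> large B \<Longrightarrow> \<exists>A\<in>\<A>. large (A \<inter> B)"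
proof -
  let ?F = "{\<A>. \<A> \<subseteq> \<N> \<and> almost_disjoint \<A>}"
  have "\<exists>\<A>\<in>?F. \<forall>\<B>\<in>?F. \<A> \<subseteq> \<B> \<longrightarrow> \<B> = \<A>"
  proof (rule subset_Zorn_nonempty)
    have "{} \<in> ?F"
      by (simp add: almost_disjoint_def)
    then show "?F \<noteq> {}"
      by (metis empty_iff)
    show "\<Union>\<C> \<in> ?F" if "\<C> \<noteq> {}" and chain: "subset.chain ?F \<C>" for \<C>
    proof -
      have F: "\<C> \<subseteq> ?F" and lin: "\<forall>\<U>\<in>\<C>. \<forall>\<V>\<in>\<C>. \<U> \<subseteq> \<V> \<or> \<V> \<subseteq> \<U>"
        using chain by (simp_all add: subset_chain_def)
      have "small (A \<inter> B)" if AB: "A \<in> \<U>" "\<U> \<in> \<C>" "B \<in> \<V>" "\<V> \<in> \<C>" "A \<noteq> B" for A B \<U> \<V>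
      proof -
        define \<W> where "\<W> = (if \<U> \<subseteq> \<V> then \<V> else \<U>)"
        have "\<W> \<in> \<C>" "A \<in> \<W>" "B \<in> \<W>"
          using bspec[OF bspec[OF lin AB(2)] AB(4)] AB by (auto simp: \<W>_def)
        moreover from this have "almost_disjoint \<W>"
          using subsetD[OF F, of \<W>] by simp
        ultimately show ?thesis
          using AB(5) by (simp add: almost_disjoint_def)
      qed
      then have "almost_disjoint (\<Union>\<C>)"
        unfolding almost_disjoint_def by (meson UnionE)
      moreover have "\<Union>\<C> \<subseteq> \<N>"
        using subsetD[OF F] by (intro Union_least) simp
      ultimately show ?thesis
        by simp
    qed
  qed
  then obtain \<A> where "\<A> \<in> ?F" and max: "\<forall>\<B>\<in>?F. \<A> \<subseteq> \<B> \<longrightarrow> \<B> = \<A>" ..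
  then have \<A>: "\<A> \<subseteq> \<N>" "almost_disjoint \<A>"
    by simp_all
  have "\<exists>A\<in>\<A>. large (A \<inter> B)" if B: "B \<in> \<N>" "large B" for B
  proof (rule ccontr)
    assume *: "\<not> ?thesis"
    then have "almost_disjoint (insert B \<A>)"
      using \<A>(2) unfolding almost_disjoint_def by (auto simp: Int_commute)
    then have "insert B \<A> = \<A>"
      using \<A>(1) B(1) bspec[OF max, of "insert B \<A>"] by (simp add: subset_insertI)
    then have "B \<in> \<A>"
      by (metis insertI1)
    then show False
      using * B(2) by (metis Int_absorb)
  qed
  then show thesis
    using that \<A> by simp
qed

text \<open>Such an \<open>A\<close> has size exactly \<kappa>. The labels are ordinals below
  \<kappa> and serve as ranks that decrease along a branch.\<close>

definition indexed :: "'b set \<Rightarrow> ('b \<Rightarrow> 'k) \<Rightarrow> bool" where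
  "indexed A e \<longleftrightarrow> large A \<and> inj_on e A \<and> e ` A \<subseteq> Field \<kappa>"

text \<open>Maximality is taken among almost disjoint families of sets that lie in a member of
  \<open>\<A>\<close> and carry strictly smaller labels. By \<open>regressive_index\<close> every
  large \<open>T\<close> inside a member contains such a set, so it cannot escape the maximal
  family.\<close>

lemma refine_almost_disjoint:
  assumes idx: "\<forall>A\<in>\<A>. indexed A (e A)"
  obtains \<B> e' where "almost_disjoint \<B>" "\<forall>B\<in>\<B>. indexed B (e' B)"
    "\<forall>B\<in>\<B>. \<exists>A\<in>\<A>. B \<subseteq> A \<and> (\<forall>x\<in>B. (e' B x, e A x) \<in> \<kappa> - Id)"
    "\<forall>A\<in>\<A>. \<forall>T\<subseteq>A. large T \<longrightarrow> (\<exists>B\<in>\<B>. large (B \<inter> T))"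
proof -
  let ?below = "\<lambda>B f. indexed B f \<and> (\<exists>A\<in>\<A>. B \<subseteq> A \<and> (\<forall>x\<in>B. (f x, e A x) \<in> \<kappa> - Id))"
  obtain \<B> where \<B>: "\<B> \<subseteq> {B. \<exists>f. ?below B f}" "almost_disjoint \<B>"
    and max: "\<And>B. B \<in> {B. \<exists>f. ?below B f} \<Longrightarrow> large B \<Longrightarrow> \<exists>A\<in>\<B>. large (A \<inter> B)"
    by (rule maximal_almost_disjoint[of "{B. \<exists>f. ?below B f}"]) blast
  have "\<forall>B\<in>\<B>. \<exists>f. ?below B f"
    using subsetD[OF \<B>(1)] by simp
  from bchoice[OF this] obtain e' where e': "\<forall>B\<in>\<B>. ?below B (e' B)" ..
  have "\<exists>B\<in>\<B>. large (B \<inter> T)" if AT: "A \<in> \<A>" "T \<subseteq> A" "large T" for A T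
  proof -
    have "inj_on (e A) T" "e A ` T \<subseteq> Field \<kappa>"
      using bspec[OF idx AT(1)] AT(2) inj_on_subset unfolding indexed_def by blast+
    from regressive_index[OF AT(3) this] obtain C f where C: "C \<subseteq> T" "large C" "inj_on f C"
      "f ` C \<subseteq> Field \<kappa>" "\<And>x. x \<in> C \<Longrightarrow> (f x, e A x) \<in> \<kappa> - Id"
      by blast
    then have "?below C f"
      using AT unfolding indexed_def by blast
    then obtain B where "B \<in> \<B>" "large (B \<inter> C)"
      using max C(2) by blast
    then show ?thesis
      using C(1) small_mono[of "B \<inter> T" "B \<inter> C"] by blast
  qed
  then show thesis
    using that[of \<B> e'] \<B>(2) e' by simp
qed

text \<open>
  If \<open>\<B>\<close> had exactly \<open>\<kappa>\<close> members, picking one point of \<open>S\<close> from each member outside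
  the preceding ones would give a large set that meets every member in a small set.
\<close>

lemma few_almost_disjoint_cover:
  assumes ad: "almost_disjoint \<B>" and mod: "moderate \<B>"
    and large: "\<And>B. B \<in> \<B> \<Longrightarrow> large (B \<inter> S)"
    and meet: "\<And>T. T \<subseteq> S \<Longrightarrow> large T \<Longrightarrow> \<exists>B\<in>\<B>. large (B \<inter> T)"
  shows "small \<B>" "small (S - \<Union>\<B>)"
proof -
  show "small (S - \<Union>\<B>)"
  proof (rule ccontr)
    assume "large (S - \<Union>\<B>)"
    then obtain B where "B \<in> \<B>" "large (B \<inter> (S - \<Union>\<B>))"
      using meet by blast
    moreover from this have "B \<inter> (S - \<Union>\<B>) = {}"
      by blast
    ultimately show False
      by (simp add: countable_imp_small)
  qed
  show "small \<B>"
  proof (rule ccontr)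
    assume "large \<B>"
    then obtain g where g: "bij_betw g (Field \<kappa>) \<B>"
      using moderate_large_bij mod by blast
    have g\<B>: "g i \<in> \<B>" if "i \<in> Field \<kappa>" for i
      using g that bij_betwE by blast
    have inj: "inj_on g (Field \<kappa>)"
      using g bij_betw_def by blast
    have pred: "small {j \<in> Field \<kappa>. (j, i) \<in> \<kappa> - Id}" if "i \<in> Field \<kappa>" for i
      using small_predecessors[of id "Field \<kappa>" i] that by simp
    \<comment> \<open>Fewer than \<kappa> earlier members remove only a small part of the large
      trace of \<open>g i\<close> on \<open>S\<close>.\<close>
    have "\<exists>t. t \<in> g i \<inter> S \<and> (\<forall>j. (j, i) \<in> \<kappa> - Id \<longrightarrow> t \<notin> g j)" if i: "i \<in> Field \<kappa>" for i
    proof -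
      let ?P = "{j \<in> Field \<kappa>. (j, i) \<in> \<kappa> - Id}"
      have "small (g i \<inter> g j)" if "j \<in> ?P" for j
      proof -
        have "g i \<noteq> g j" "g i \<in> \<B>" "g j \<in> \<B>"
          using inj_onD[OF inj, of i j] g\<B> i that by auto
        then show ?thesis
          using ad by (simp add: almost_disjoint_def)
      qed
      then have "small (\<Union>j\<in>?P. g i \<inter> g j)"
        by (rule small_UN[OF pred[OF i]])
      then have "large (g i \<inter> S - (\<Union>j\<in>?P. g i \<inter> g j))"
        by (rule large_Diff[OF large[OF g\<B>[OF i]]])
      then have "g i \<inter> S - (\<Union>j\<in>?P. g i \<inter> g j) \<noteq> {}"
        by (rule large_nonempty)
      then obtain t where "t \<in> g i \<inter> S - (\<Union>j\<in>?P. g i \<inter> g j)"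
        by (meson ex_in_conv)
      then have t: "t \<in> g i \<inter> S" and not: "\<forall>j\<in>?P. t \<notin> g j"
        by auto
      have "t \<notin> g j" if "(j, i) \<in> \<kappa> - Id" for j
        using not that FieldI1[of j i \<kappa>] by simp
      then show ?thesis
        using t by blast
    qed
    then have "\<forall>i\<in>Field \<kappa>. \<exists>t. t \<in> g i \<inter> S \<and> (\<forall>j. (j, i) \<in> \<kappa> - Id \<longrightarrow> t \<notin> g j)" ..
    from bchoice[OF this] obtain t
      where t': "\<forall>i\<in>Field \<kappa>. t i \<in> g i \<inter> S \<and> (\<forall>j. (j, i) \<in> \<kappa> - Id \<longrightarrow> t i \<notin> g j)" ..
    have t: "\<And>i. i \<in> Field \<kappa> \<Longrightarrow> t i \<in> g i \<inter> S"
      "\<And>i j. i \<in> Field \<kappa> \<Longrightarrow> (j, i) \<in> \<kappa> - Id \<Longrightarrow> t i \<notin> g j"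
      using t' by blast+
    have "inj_on t (Field \<kappa>)"
    proof (rule inj_onI, rule ccontr)
      fix i j assume ij: "i \<in> Field \<kappa>" "j \<in> Field \<kappa>" "t i = t j" "i \<noteq> j"
      have "(i, j) \<in> \<kappa> - Id \<or> (j, i) \<in> \<kappa> - Id"
        using trichotomy[OF ij(1,2)] ij(4) by blast
      then show False
        using t(1)[OF ij(1)] t(1)[OF ij(2)] t(2)[of i j] t(2)[of j i] ij(1,2,3) by auto
    qed
    then have "large (t ` Field \<kappa>)"
      using large_Field large_inj_image by blast
    then obtain B where B: "B \<in> \<B>" "large (B \<inter> t ` Field \<kappa>)"
      using meet[of "t ` Field \<kappa>"] t(1) by blast
    then obtain j where j: "j \<in> Field \<kappa>" "B = g j"
      using g by (auto simp: bij_betw_def)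
    \<comment> \<open>Points chosen after stage \<open>j\<close> avoid \<open>g j\<close>.\<close>
    have "B \<inter> t ` Field \<kappa> \<subseteq> t ` insert j {i \<in> Field \<kappa>. (i, j) \<in> \<kappa> - Id}"
    proof
      fix x assume "x \<in> B \<inter> t ` Field \<kappa>"
      then obtain i where i: "i \<in> Field \<kappa>" "x = t i" "t i \<in> g j"
        using j by blast
      then have "(j, i) \<notin> \<kappa> - Id"
        using t(2) by blast
      then show "x \<in> t ` insert j {i \<in> Field \<kappa>. (i, j) \<in> \<kappa> - Id}"
        using trichotomy[OF i(1) j(1)] i by blast
    qed
    moreover have "small (insert j {i \<in> Field \<kappa>. (i, j) \<in> \<kappa> - Id})"
      using small_Un[OF countable_imp_small[of "{j}"] pred[OF j(1)]] by simp
    ultimately show False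
      using B(2) small_image small_mono by blast
  qed
qed

text \<open>
  Otherwise every node would have a small set of children that cover its part of \<open>S\<close> up to a
  small set. Some point of \<open>S\<close> would then lie on an infinite branch, along which its indices decrease.
\<close>

lemma almost_disjoint_tree:
  fixes Z :: "'b set"
  assumes Z: "moderate Z" "large Z"
  obtains \<A> :: "nat \<Rightarrow> 'b set set" where
    "\<forall>n. almost_disjoint (\<A> n)"
    "\<forall>n. \<forall>A\<in>\<A> n. A \<subseteq> Z \<and> large A"
    "\<forall>n. \<forall>B\<in>\<A> (Suc n). \<exists>A\<in>\<A> n. B \<subseteq> A"
    "\<forall>S\<subseteq>Z. large S \<longrightarrow>
      (\<exists>n. \<exists>N\<in>\<A> n. \<not> moderate {B \<in> \<A> (Suc n). B \<subseteq> N \<and> large (B \<inter> S)})"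
proof -
  obtain e\<^sub>0 where e\<^sub>0: "inj_on e\<^sub>0 Z" "e\<^sub>0 ` Z \<subseteq> Field \<kappa>"
    using Z(1) unfolding moderate_iff_inj by (elim exE conjE)
  \<comment> \<open>A level pairs a family with a labelling of each of its members.
    \<open>step\<close> records that labels drop and that no large set escapes the next
    level.\<close>
  define level where "level p \<longleftrightarrow> almost_disjoint (fst p) \<and> (\<forall>A\<in>fst p. A \<subseteq> Z \<and> indexed A (snd p A))"
    for p :: "'b set set \<times> ('b set \<Rightarrow> 'b \<Rightarrow> 'k)"
  define step where "step p p' \<longleftrightarrow>
      (\<forall>B\<in>fst p'. \<exists>A\<in>fst p. B \<subseteq> A \<and> (\<forall>x\<in>B. (snd p' B x, snd p A x) \<in> \<kappa> - Id)) \<and>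
      (\<forall>A\<in>fst p. \<forall>T\<subseteq>A. large T \<longrightarrow> (\<exists>B\<in>fst p'. large (B \<inter> T)))"
    for p p' :: "'b set set \<times> ('b set \<Rightarrow> 'b \<Rightarrow> 'k)"
  have "\<exists>f. \<forall>n. (level (f n) \<and> (n = 0 \<longrightarrow> fst (f n) = {Z})) \<and> step (f n) (f (Suc n))"
  proof (rule dependent_nat_choice)
    show "\<exists>p. level p \<and> ((0 :: nat) = 0 \<longrightarrow> fst p = {Z})"
      by (rule exI[of _ "({Z}, \<lambda>_. e\<^sub>0)"])
        (use Z e\<^sub>0 in \<open>simp add: level_def almost_disjoint_def indexed_def\<close>)
    fix p and n :: nat assume "level p \<and> (n = 0 \<longrightarrow> fst p = {Z})"
    then have p: "almost_disjoint (fst p)" "\<And>A. A \<in> fst p \<Longrightarrow> A \<subseteq> Z"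
      "\<forall>A\<in>fst p. indexed A (snd p A)"
      by (simp_all add: level_def)
    obtain \<B> e' where \<B>: "almost_disjoint \<B>" "\<forall>B\<in>\<B>. indexed B (e' B)"
      "\<forall>B\<in>\<B>. \<exists>A\<in>fst p. B \<subseteq> A \<and> (\<forall>x\<in>B. (e' B x, snd p A x) \<in> \<kappa> - Id)"
      "\<forall>A\<in>fst p. \<forall>T\<subseteq>A. large T \<longrightarrow> (\<exists>B\<in>\<B>. large (B \<inter> T))"
      by (rule refine_almost_disjoint[OF p(3)]) (rule that)
    have "level (\<B>, e')"
      unfolding level_def fst_conv snd_conv using \<B>(1-3) p(2) by (meson subset_trans)
    moreover have "step p (\<B>, e')"
      unfolding step_def fst_conv snd_conv using \<B>(3,4) by simp
    ultimately show "\<exists>p'. (level p' \<and> (Suc n = 0 \<longrightarrow> fst p' = {Z})) \<and> step p p'"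
      by (intro exI[of _ "(\<B>, e')"]) simp
  qed
  then obtain f where f: "\<And>n. level (f n)" "fst (f 0) = {Z}" "\<And>n. step (f n) (f (Suc n))"
    by auto
  define \<A> where "\<A> n = fst (f n)" for n
  define e where "e n = snd (f n)" for n
  have ad: "almost_disjoint (\<A> n)" and sub: "\<And>A. A \<in> \<A> n \<Longrightarrow> A \<subseteq> Z"
    and large: "\<And>A. A \<in> \<A> n \<Longrightarrow> large A" for n
    using f(1)[of n] by (simp_all add: level_def \<A>_def indexed_def)
  have parent: "\<exists>A\<in>\<A> n. B \<subseteq> A \<and> (\<forall>x\<in>B. (e (Suc n) B x, e n A x) \<in> \<kappa> - Id)"
    if "B \<in> \<A> (Suc n)" for B n
    using f(3)[of n] that by (simp add: step_def \<A>_def e_def)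
  have meet: "\<exists>B\<in>\<A> (Suc n). large (B \<inter> T)" if "A \<in> \<A> n" "T \<subseteq> A" "large T" for A T n
    using f(3)[of n] that by (simp add: step_def \<A>_def)
  have main: "\<exists>n. \<exists>N\<in>\<A> n. \<not> moderate {B \<in> \<A> (Suc n). B \<subseteq> N \<and> large (B \<inter> S)}"
    if S: "S \<subseteq> Z" "large S" for S
  proof (rule ccontr)
    define ch where "ch n N = {B \<in> \<A> (Suc n). B \<subseteq> N \<and> large (B \<inter> S)}" for n N
    assume "\<not> ?thesis"
    then have mod: "moderate (ch n N)" if "N \<in> \<A> n" for n N
      using that by (auto simp: ch_def)
    have key: "small (ch n N)" "small (N \<inter> S - \<Union>(ch n N))"
      if N: "N \<in> \<A> n" "large (N \<inter> S)" for n N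
    proof -
      have 1: "almost_disjoint (ch n N)"
        using ad[of "Suc n"] by (auto simp: almost_disjoint_def ch_def)
      have 2: "large (B \<inter> (N \<inter> S))" if "B \<in> ch n N" for B
      proof -
        have "B \<inter> (N \<inter> S) = B \<inter> S"
          using that by (auto simp: ch_def)
        then show ?thesis
          using that by (simp add: ch_def)
      qed
      have 3: "\<exists>B\<in>ch n N. large (B \<inter> T)" if T: "T \<subseteq> N \<inter> S" "large T" for T
      proof -
        obtain B where B: "B \<in> \<A> (Suc n)" "large (B \<inter> T)"
          using meet[OF N(1) _ T(2)] T(1) by auto
        obtain A where A: "A \<in> \<A> n" "B \<subseteq> A"
          using parent[OF B(1)] by auto
        have "A = N"
          by (rule almost_disjoint_large_subset[OF ad A(1) N(1) B(2)]) (use A T in auto)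
        moreover have "large (B \<inter> S)"
          using B(2) T(1) small_mono[of "B \<inter> S" "B \<inter> T"] by auto
        ultimately show ?thesis
          using A B by (intro bexI[of _ B]) (simp_all add: ch_def)
      qed
      show "small (ch n N)" "small (N \<inter> S - \<Union>(ch n N))"
        using few_almost_disjoint_cover[OF 1 mod[OF N(1)] 2 3] by simp_all
    qed
    \<comment> \<open>The nodes with large trace on \<open>S\<close>. Each has fewer than \<kappa>
      children of this kind, so by induction each level has fewer than \<kappa> of them.\<close>
    define G where "G n = {N \<in> \<A> n. large (N \<inter> S)}" for n
    have G: "small (G n)" for n
    proof (induction n)
      case 0
      have "G 0 \<subseteq> {Z}"
        using f(2) by (auto simp: G_def \<A>_def)
      then show ?case
        by (rule small_mono[rotated]) (simp add: countable_imp_small)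
    next
      case (Suc n)
      have "G (Suc n) \<subseteq> (\<Union>N\<in>G n. ch n N)"
      proof
        fix B assume B: "B \<in> G (Suc n)"
        then obtain A where A: "A \<in> \<A> n" "B \<subseteq> A"
          using parent[of B n] by (auto simp: G_def)
        then have "large (A \<inter> S)"
          using B small_mono[of "A \<inter> S" "B \<inter> S"] by (auto simp: G_def)
        then show "B \<in> (\<Union>N\<in>G n. ch n N)"
          using A B by (auto simp: G_def ch_def)
      qed
      moreover have "small (\<Union>N\<in>G n. ch n N)"
        using Suc key(1) by (intro small_UN) (auto simp: G_def)
      ultimately show ?case
        by (rule small_mono[rotated])
    qed
    \<comment> \<open>The points of \<open>S\<close> that some node loses on the way to its
      children. Countably many levels together lose only a small set, since \<kappa> is regular and
      uncountable.\<close>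
    define X where "X = (\<Union>n. \<Union>N\<in>G n. N \<inter> S - \<Union>(ch n N))"
    have "small X"
      unfolding X_def
    proof (rule small_UN)
      show "small (UNIV :: nat set)"
        by (rule countable_imp_small) simp
      show "small (\<Union>N\<in>G n. N \<inter> S - \<Union>(ch n N))" for n
        using small_UN[OF G, of n "\<lambda>N. N \<inter> S - \<Union>(ch n N)"] key(2) by (simp add: G_def)
    qed
    then have "S - X \<noteq> {}"
      using S(2) by (intro large_nonempty large_Diff)
    then obtain x where x: "x \<in> S" "x \<notin> X"
      by auto
    have "\<exists>N. \<forall>n. (N n \<in> G n \<and> x \<in> N n) \<and> (e (Suc n) (N (Suc n)) x, e n (N n) x) \<in> \<kappa> - Id"
    proof (rule dependent_nat_choice)
      show "\<exists>N. N \<in> G 0 \<and> x \<in> N"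
        using f(2) S x by (intro exI[of _ Z]) (auto simp: G_def \<A>_def Int_absorb1)
      fix N n assume N: "N \<in> G n \<and> x \<in> N"
      then obtain B where B: "B \<in> ch n N" "x \<in> B"
        using x by (auto simp: X_def)
      then have B': "B \<in> \<A> (Suc n)" "B \<subseteq> N" "large (B \<inter> S)"
        by (simp_all add: ch_def)
      obtain A where A: "A \<in> \<A> n" "B \<subseteq> A" "\<forall>x\<in>B. (e (Suc n) B x, e n A x) \<in> \<kappa> - Id"
        using parent[OF B'(1)] by auto
      have "N \<in> \<A> n"
        using N by (simp add: G_def)
      then have "A = N"
        by (rule almost_disjoint_large_subset[OF ad A(1) _ large[OF B'(1)] A(2) B'(2)])
      then show "\<exists>N'. (N' \<in> G (Suc n) \<and> x \<in> N') \<and> (e (Suc n) N' x, e n N x) \<in> \<kappa> - Id"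
        using A B B' by (intro exI[of _ B]) (simp add: G_def)
    qed
    then obtain N where "\<forall>n. (e (Suc n) (N (Suc n)) x, e n (N n) x) \<in> \<kappa> - Id"
      by auto
    then have "\<exists>f. \<forall>n. (f (Suc n), f n) \<in> \<kappa> - Id"
      by (rule exI[of _ "\<lambda>n. e n (N n) x"])
    then show False
      using wf_strict unfolding wf_iff_no_infinite_down_chain by simp
  qed
  have "\<exists>A\<in>\<A> n. B \<subseteq> A" if "B \<in> \<A> (Suc n)" for n B
    using parent[OF that] by auto
  then show thesis
    using that[of \<A>] ad sub large main by simp
qed

lemma moderate_pigeonhole:
  assumes \<B>: "\<not> moderate \<B>" and P: "moderate P"
    and r: "\<And>B. B \<in> \<B> \<Longrightarrow> \<exists>q\<in>P. r q B"
  shows "\<exists>q\<in>P. \<not> moderate {B \<in> \<B>. r q B}"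
proof (rule ccontr)
  assume "\<not> ?thesis"
  then have "moderate (\<Union>q\<in>P. {B \<in> \<B>. r q B})"
    by (intro moderate_UN P) auto
  moreover have "\<B> \<subseteq> (\<Union>q\<in>P. {B \<in> \<B>. r q B})"
    using r by auto
  ultimately show False
    using \<B> moderate_mono by metis
qed

text \<open>
  The set \<open>R\<close> consists of the points that accumulate at more than \<open>\<kappa>\<close> children of a common node.
  This leaves room to choose, for all \<open>q \<in> R\<close> and \<open>k\<close>, distinct children that almost miss the
  nodes of deeper levels. The chosen children are moderately many and pairwise almost disjoint, so
  removing small sets makes them disjoint.
\<close>

lemma disjoint_selection:
  fixes Acc :: "'q \<Rightarrow> 'b set \<Rightarrow> bool"
  assumes Z: "moderate Z" and P: "moderate P"
    and mono: "\<And>q A B. Acc q A \<Longrightarrow> A \<subseteq> B \<Longrightarrow> Acc q B"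
  obtains R and D :: "'q \<Rightarrow> nat \<Rightarrow> 'b set" where "R \<subseteq> P"
    "\<forall>q\<in>R. \<forall>k. D q k \<subseteq> Z \<and> (\<exists>B U. Acc q B \<and> small U \<and> D q k = B - U)"
    "\<forall>q\<in>R. \<forall>q'\<in>R. \<forall>k k'. (q, k) \<noteq> (q', k') \<longrightarrow> D q k \<inter> D q' k' = {}"
    "\<forall>S P'. S \<subseteq> Z \<longrightarrow> large S \<longrightarrow> P' \<subseteq> P \<longrightarrow>
      (\<forall>B\<subseteq>S. large B \<longrightarrow> (\<exists>q\<in>P'. Acc q B)) \<longrightarrow> R \<inter> P' \<noteq> {}"
proof (cases "large Z")
  case False
  then have no: "\<not> (S \<subseteq> Z \<and> large S)" for S
    using small_mono by auto
  show thesis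
    by (rule that[of "{}" "\<lambda>_ _. {}"]) (use no in auto)
next
  case True
  obtain \<A> :: "nat \<Rightarrow> 'b set set" where \<A>: "\<forall>n. almost_disjoint (\<A> n)"
    "\<forall>n. \<forall>A\<in>\<A> n. A \<subseteq> Z \<and> large A"
    "\<forall>n. \<forall>B\<in>\<A> (Suc n). \<exists>A\<in>\<A> n. B \<subseteq> A"
    "\<forall>S\<subseteq>Z. large S \<longrightarrow>
      (\<exists>n. \<exists>N\<in>\<A> n. \<not> moderate {B \<in> \<A> (Suc n). B \<subseteq> N \<and> large (B \<inter> S)})"
    by (rule almost_disjoint_tree[OF Z True]) (rule that)
  have ad: "almost_disjoint (\<A> n)" for n
    using \<A>(1) by simp
  have sub: "A \<subseteq> Z \<and> large A" if "A \<in> \<A> n" for n A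
    using \<A>(2) that by simp
  have parent: "\<exists>A\<in>\<A> n. B \<subseteq> A" if "B \<in> \<A> (Suc n)" for n B
    using \<A>(3) that by simp
  have many: "\<exists>n. \<exists>N\<in>\<A> n. \<not> moderate {B \<in> \<A> (Suc n). B \<subseteq> N \<and> large (B \<inter> S)}"
    if "S \<subseteq> Z" "large S" for S
    using \<A>(4) that by simp
  have ancestor: "\<exists>A\<in>\<A> n. N \<subseteq> A" if "N \<in> \<A> m" "n \<le> m" for N m n
    using that(2,1)
  proof (induction m arbitrary: N rule: dec_induct)
    case (step m)
    then show ?case
      using parent[of N m] by (meson subset_trans)
  qed auto
  define R where "R = {q \<in> P. \<exists>n. \<exists>N\<in>\<A> n. \<not> moderate {B \<in> \<A> (Suc n). B \<subseteq> N \<and> Acc q B}}"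
  have "\<forall>q\<in>R. \<exists>p. snd p \<in> \<A> (fst p) \<and> \<not> moderate {B \<in> \<A> (Suc (fst p)). B \<subseteq> snd p \<and> Acc q B}"
    unfolding R_def by auto
  from bchoice[OF this] obtain node
    where node: "\<forall>q\<in>R. snd (node q) \<in> \<A> (fst (node q)) \<and>
      \<not> moderate {B \<in> \<A> (Suc (fst (node q))). B \<subseteq> snd (node q) \<and> Acc q B}" ..
  define l where "l q = Suc (fst (node q))" for q
  define N where "N q = snd (node q)" for q
  have N: "N q \<in> \<A> (fst (node q))" "\<not> moderate {B \<in> \<A> (l q). B \<subseteq> N q \<and> Acc q B}" if "q \<in> R" for q
    using node that by (simp_all add: l_def N_def)
  have R: "moderate R"
    using P by (rule moderate_mono) (auto simp: R_def)
  define C where "C q = {B \<in> \<A> (l q). B \<subseteq> N q \<and> Acc q B \<and>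
    (\<forall>q'\<in>R. l q < l q' \<longrightarrow> small (B \<inter> N q'))}" for q
  have C: "\<not> moderate (C q)" if q: "q \<in> R" for q
  proof
    assume mod: "moderate (C q)"
    \<comment> \<open>A deeper node \<open>N q'\<close> lies in one member of level
      \<open>l q\<close>, so by almost disjointness it rules out at most one child for
      \<open>q\<close>.\<close>
    let ?bad = "\<Union>q'\<in>R. {B \<in> \<A> (l q). l q < l q' \<and> large (B \<inter> N q')}"
    have "moderate {B \<in> \<A> (l q). l q < l q' \<and> large (B \<inter> N q')}" if q': "q' \<in> R" for q'
    proof (cases "l q < l q'")
      case True
      then have "l q \<le> fst (node q')"
        by (simp add: l_def)
      then obtain A where A: "A \<in> \<A> (l q)" "N q' \<subseteq> A"
        using ancestor[OF N(1)[OF q']] by auto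
      have "{B \<in> \<A> (l q). l q < l q' \<and> large (B \<inter> N q')} \<subseteq> {A}"
      proof (rule subsetI)
        fix B assume "B \<in> {B \<in> \<A> (l q). l q < l q' \<and> large (B \<inter> N q')}"
        then have B: "B \<in> \<A> (l q)" "large (B \<inter> N q')"
          by simp_all
        have "B = A"
          by (rule almost_disjoint_large_subset[OF ad B(1) A(1) B(2)]) (use A in auto)
        then show "B \<in> {A}"
          by simp
      qed
      then show ?thesis
        by (rule moderate_mono[rotated]) (simp add: small_imp_moderate countable_imp_small)
    qed (simp add: small_imp_moderate countable_imp_small)
    then have "moderate ?bad"
      by (rule moderate_UN[OF R])
    then have "moderate (C q \<union> ?bad)"
      using mod by (rule moderate_Un[rotated])
    moreover have "{B \<in> \<A> (l q). B \<subseteq> N q \<and> Acc q B} \<subseteq> C q \<union> ?bad"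
    proof (rule subsetI)
      fix B assume "B \<in> {B \<in> \<A> (l q). B \<subseteq> N q \<and> Acc q B}"
      then show "B \<in> C q \<union> ?bad"
        unfolding C_def UN_iff Un_iff mem_Collect_eq by metis
    qed
    ultimately have "moderate {B \<in> \<A> (l q). B \<subseteq> N q \<and> Acc q B}"
      by (rule moderate_mono)
    then show False
      using N(2)[OF q] by simp
  qed
  \<comment> \<open>Countably many sets per point, one for each of the \<omega> dense sets to be
    formed.\<close>
  define I where "I = R \<times> (UNIV :: nat set)"
  have I: "moderate I"
    unfolding I_def by (intro moderate_Times R small_imp_moderate countable_imp_small) simp
  have "\<forall>i\<in>I. \<not> moderate (C (fst i))"
    using C by (auto simp: I_def)
  then obtain b where b_inj: "inj_on b I" and b': "\<forall>i\<in>I. b i \<in> C (fst i)"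
    by (rule injective_choice[OF I]) (rule that)
  note b = b_inj bspec[OF b']
  obtain g where g: "inj_on g I" "g ` I \<subseteq> Field \<kappa>"
    using I unfolding moderate_iff_inj by (elim exE conjE)
  \<comment> \<open>On equal levels the sets are distinct members of one almost disjoint family; on
    different levels the deeper one lies inside a node that the other almost misses.\<close>
  have b_ad: "small (b i \<inter> b j)" if ij: "i \<in> I" "j \<in> I" "i \<noteq> j" for i j
  proof -
    have ne: "b i \<noteq> b j"
      using ij b(1) by (auto dest: inj_onD)
    have *: "small (b i \<inter> b j)" if "i \<in> I" "j \<in> I" "l (fst i) < l (fst j)" for i j
    proof -
      have "fst j \<in> R"
        using that(2) by (auto simp: I_def)
      then have "small (b i \<inter> N (fst j))" and "b j \<subseteq> N (fst j)"
        using b(2)[OF that(1)] b(2)[OF that(2)] that(3) by (auto simp: C_def)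
      then show ?thesis
        using small_mono by (metis Int_mono order_refl)
    qed
    show ?thesis
    proof (cases "l (fst i)" "l (fst j)" rule: linorder_cases)
      case equal
      then have "b i \<in> \<A> (l (fst i))" "b j \<in> \<A> (l (fst i))"
        using b(2)[OF ij(1)] b(2)[OF ij(2)] by (simp_all add: C_def)
      then show ?thesis
        using ad ne by (simp add: almost_disjoint_def)
    next
      case less
      then show ?thesis
        by (rule *[OF ij(1,2)])
    next
      case greater
      then show ?thesis
        using *[OF ij(2,1)] by (simp add: Int_commute)
    qed
  qed
  define U where "U i = (\<Union>j\<in>{j \<in> I. (g j, g i) \<in> \<kappa> - Id}. b i \<inter> b j)" for i
  have U: "small (U i)" if i: "i \<in> I" for i
    unfolding U_def
    by (rule small_UN[OF small_predecessors[OF g i]]) (rule b_ad[OF i], auto)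
  define D where "D q k = b (q, k) - U (q, k)" for q k
  have disj: "(b i - U i) \<inter> (b j - U j) = {}" if ij: "i \<in> I" "j \<in> I" "i \<noteq> j" for i j
  proof -
    have "g i \<noteq> g j" "g i \<in> Field \<kappa>" "g j \<in> Field \<kappa>"
      using ij g by (auto dest: inj_onD)
    then have "(g i, g j) \<in> \<kappa> - Id \<or> (g j, g i) \<in> \<kappa> - Id"
      using trichotomy by metis
    then show ?thesis
      using ij by (auto simp: U_def)
  qed
  show thesis
  proof (rule that[of R D])
    show "R \<subseteq> P"
      by (auto simp: R_def)
    show "\<forall>q\<in>R. \<forall>k. D q k \<subseteq> Z \<and> (\<exists>B U. Acc q B \<and> small U \<and> D q k = B - U)"
    proof (intro ballI allI)
      fix q and k :: nat assume "q \<in> R"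
      then have i: "(q, k) \<in> I"
        by (simp add: I_def)
      then have "b (q, k) \<in> \<A> (l q)" "Acc q (b (q, k))"
        using b(2)[of "(q, k)"] by (simp_all add: C_def)
      then show "D q k \<subseteq> Z \<and> (\<exists>B U. Acc q B \<and> small U \<and> D q k = B - U)"
        using sub[of "b (q, k)" "l q"] U[OF i] by (auto simp: D_def)
    qed
    show "\<forall>q\<in>R. \<forall>q'\<in>R. \<forall>k k'. (q, k) \<noteq> (q', k') \<longrightarrow> D q k \<inter> D q' k' = {}"
    proof (intro ballI allI impI)
      fix q q' and k k' :: nat assume "q \<in> R" "q' \<in> R" "(q, k) \<noteq> (q', k')"
      then show "D q k \<inter> D q' k' = {}"
        using disj[of "(q, k)" "(q', k')"] by (simp add: D_def I_def)
    qed
    show "\<forall>S P'. S \<subseteq> Z \<longrightarrow> large S \<longrightarrow> P' \<subseteq> P \<longrightarrow>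
      (\<forall>B\<subseteq>S. large B \<longrightarrow> (\<exists>q\<in>P'. Acc q B)) \<longrightarrow> R \<inter> P' \<noteq> {}"
    proof (intro allI impI)
      fix S P' assume S: "S \<subseteq> Z" "large S" and P': "P' \<subseteq> P"
        and acc: "\<forall>B\<subseteq>S. large B \<longrightarrow> (\<exists>q\<in>P'. Acc q B)"
      obtain n M where M: "M \<in> \<A> n" "\<not> moderate {B \<in> \<A> (Suc n). B \<subseteq> M \<and> large (B \<inter> S)}"
        using many[OF S] by auto
      \<comment> \<open>The trace of \<open>B\<close> on \<open>S\<close> is a large subset of
        \<open>S\<close>, so some \<open>q\<close> in \<open>P'\<close> belongs to it. More than
        \<kappa> children share at most \<kappa> such points.\<close>
      have "\<exists>q\<in>P'. Acc q B" if B: "B \<in> {B \<in> \<A> (Suc n). B \<subseteq> M \<and> large (B \<inter> S)}" for B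
      proof -
        obtain q where "q \<in> P'" "Acc q (B \<inter> S)"
          using acc[rule_format, of "B \<inter> S"] B by auto
        then show ?thesis
          using mono[of q "B \<inter> S" B] by auto
      qed
      from moderate_pigeonhole[OF M(2) moderate_mono[OF P P'] this]
      obtain q where q: "q \<in> P'"
        "\<not> moderate {B \<in> {B \<in> \<A> (Suc n). B \<subseteq> M \<and> large (B \<inter> S)}. Acc q B}" ..
      have "\<not> moderate {B \<in> \<A> (Suc n). B \<subseteq> M \<and> Acc q B}"
      proof
        assume "moderate {B \<in> \<A> (Suc n). B \<subseteq> M \<and> Acc q B}"
        then have "moderate {B \<in> {B \<in> \<A> (Suc n). B \<subseteq> M \<and> large (B \<inter> S)}. Acc q B}"
          by (rule moderate_mono) auto
        then show False
          using q(2) by simp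
      qed
      then have "q \<in> R"
        using q(1) P' M(1) by (auto simp: R_def)
      then show "R \<inter> P' \<noteq> {}"
        using q(1) by auto
    qed
  qed
qed

end

section \<open>Splitting into dense sets\<close>

definition rel_dense :: "'a topology \<Rightarrow> 'a set \<Rightarrow> 'a set \<Rightarrow> bool" where
  "rel_dense X D Y \<longleftrightarrow> D \<subseteq> Y \<and> (\<forall>W. openin X W \<longrightarrow> W \<inter> Y \<noteq> {} \<longrightarrow> W \<inter> D \<noteq> {})"

text \<open>For \<open>I = {0, 1}\<close> this is resolvability of the subspace \<open>Y\<close>,
  for \<open>UNIV\<close> it is \<omega>-resolvability. The empty set splits for every
  \<open>I\<close>, so nonemptiness is demanded separately where it matters.\<close>

definition split_into :: "'a topology \<Rightarrow> nat set \<Rightarrow> 'a set \<Rightarrow> bool" where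
  "split_into X I Y \<longleftrightarrow> (\<exists>C. disjoint_family_on C I \<and> (\<forall>i\<in>I. rel_dense X (C i) Y))"

abbreviation omega_split :: "'a topology \<Rightarrow> 'a set \<Rightarrow> bool" where
  "omega_split X \<equiv> split_into X UNIV"

text \<open>This is open hereditary irresolvability: no nonempty relatively open part of
  \<open>D\<close> splits into two dense subsets.\<close>

definition decisive :: "'a topology \<Rightarrow> 'a set \<Rightarrow> bool" where
  "decisive X D \<longleftrightarrow> (\<forall>M W. openin X W \<longrightarrow> W \<inter> D \<noteq> {} \<longrightarrow>
    (\<exists>V. openin X V \<and> V \<subseteq> W \<and> V \<inter> D \<noteq> {} \<and> (V \<inter> D \<inter> M = {} \<or> V \<inter> D \<subseteq> M)))"

lemma rel_denseI:
  assumes "D \<subseteq> Y" "\<And>W. openin X W \<Longrightarrow> W \<inter> Y \<noteq> {} \<Longrightarrow> W \<inter> D \<noteq> {}"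
  shows "rel_dense X D Y"
  using assms by (simp add: rel_dense_def)

lemma rel_dense_subset: "rel_dense X D Y \<Longrightarrow> D \<subseteq> Y"
  by (simp add: rel_dense_def)

lemma rel_dense_meets: "rel_dense X D Y \<Longrightarrow> openin X W \<Longrightarrow> W \<inter> Y \<noteq> {} \<Longrightarrow> W \<inter> D \<noteq> {}"
  by (simp add: rel_dense_def)

lemma rel_dense_trans: "rel_dense X D E \<Longrightarrow> rel_dense X E Y \<Longrightarrow> rel_dense X D Y"
  unfolding rel_dense_def by auto

lemma rel_dense_mono: "rel_dense X D Y \<Longrightarrow> D \<subseteq> E \<Longrightarrow> E \<subseteq> Y \<Longrightarrow> rel_dense X E Y"
  unfolding rel_dense_def by fast

lemma rel_dense_open:
  assumes "rel_dense X D Y" "openin X V"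
  shows "rel_dense X (V \<inter> D) (V \<inter> Y)"
proof (rule rel_denseI)
  show "V \<inter> D \<subseteq> V \<inter> Y"
    using rel_dense_subset[OF assms(1)] by auto
  fix W assume "openin X W" "W \<inter> (V \<inter> Y) \<noteq> {}"
  then show "W \<inter> (V \<inter> D) \<noteq> {}"
    using rel_dense_meets[OF assms(1), of "W \<inter> V"] assms(2) by (simp add: Int_assoc openin_Int)
qed

lemma decisive_open:
  assumes "decisive X D" "openin X U"
  shows "decisive X (U \<inter> D)"
  unfolding decisive_def
proof (intro allI impI)
  fix M W assume "openin X W" "W \<inter> (U \<inter> D) \<noteq> {}"
  then have "openin X (W \<inter> U)" "(W \<inter> U) \<inter> D \<noteq> {}"
    using assms(2) by (auto simp: Int_assoc)
  then obtain V where "openin X V" "V \<subseteq> W \<inter> U" "V \<inter> D \<noteq> {}" "V \<inter> D \<inter> M = {} \<or> V \<inter> D \<subseteq> M"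
    using assms(1) unfolding decisive_def by meson
  moreover from this have "V \<inter> (U \<inter> D) = V \<inter> D"
    by auto
  ultimately show "\<exists>V. openin X V \<and> V \<subseteq> W \<and> V \<inter> (U \<inter> D) \<noteq> {} \<and>
      (V \<inter> (U \<inter> D) \<inter> M = {} \<or> V \<inter> (U \<inter> D) \<subseteq> M)"
    by (intro exI[of _ V]) simp
qed

text \<open>The Zorn argument behind every gluing below. Members are kept nonempty, so a set inside
  an open \<open>W\<close> that misses all members is really new.\<close>

lemma maximal_disjoint_family:
  assumes ex: "\<And>W. openin X W \<Longrightarrow> W \<inter> Y \<noteq> {} \<Longrightarrow> \<exists>Z. Q Z \<and> Z \<noteq> {} \<and> Z \<subseteq> W \<inter> Y"
  obtains \<Z> where "disjoint \<Z>" "\<forall>Z\<in>\<Z>. Q Z \<and> Z \<subseteq> Y"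
    "\<forall>W. openin X W \<longrightarrow> W \<inter> Y \<noteq> {} \<longrightarrow> (\<exists>Z\<in>\<Z>. W \<inter> Z \<noteq> {})"
proof -
  let ?F = "{\<Z>. disjoint \<Z> \<and> (\<forall>Z\<in>\<Z>. Q Z \<and> Z \<noteq> {} \<and> Z \<subseteq> Y)}"
  have "\<exists>\<Z>\<in>?F. \<forall>\<Z>'\<in>?F. \<Z> \<subseteq> \<Z>' \<longrightarrow> \<Z>' = \<Z>"
  proof (rule subset_Zorn_nonempty)
    have "{} \<in> ?F"
      by simp
    then show "?F \<noteq> {}"
      by (metis empty_iff)
    show "\<Union>\<C> \<in> ?F" if "\<C> \<noteq> {}" and chain: "subset.chain ?F \<C>" for \<C>
    proof -
      have F: "\<C> \<subseteq> ?F" and lin: "\<forall>\<U>\<in>\<C>. \<forall>\<V>\<in>\<C>. \<U> \<subseteq> \<V> \<or> \<V> \<subseteq> \<U>"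
        using chain by (simp_all add: subset_chain_def)
      have "A \<inter> B = {}" if AB: "A \<in> \<U>" "\<U> \<in> \<C>" "B \<in> \<V>" "\<V> \<in> \<C>" "A \<noteq> B" for A B \<U> \<V>
      proof -
        define \<W> where "\<W> = (if \<U> \<subseteq> \<V> then \<V> else \<U>)"
        have "\<W> \<in> \<C>" "A \<in> \<W>" "B \<in> \<W>"
          using bspec[OF bspec[OF lin AB(2)] AB(4)] AB by (auto simp: \<W>_def)
        moreover from this have "disjoint \<W>"
          using subsetD[OF F, of \<W>] by simp
        ultimately show ?thesis
          using AB(5) by (simp add: disjoint_def)
      qed
      then have "disjoint (\<Union>\<C>)"
        unfolding disjoint_def by (meson UnionE)
      moreover have "\<forall>Z\<in>\<Union>\<C>. Q Z \<and> Z \<noteq> {} \<and> Z \<subseteq> Y"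
        using subsetD[OF F] by simp
      ultimately show ?thesis
        by simp
    qed
  qed
  then obtain \<Z> where "\<Z> \<in> ?F" and max: "\<forall>\<Z>'\<in>?F. \<Z> \<subseteq> \<Z>' \<longrightarrow> \<Z>' = \<Z>" ..
  then have \<Z>: "disjoint \<Z>" "\<forall>Z\<in>\<Z>. Q Z \<and> Z \<noteq> {} \<and> Z \<subseteq> Y"
    by simp_all
  have "\<exists>Z\<in>\<Z>. W \<inter> Z \<noteq> {}" if W: "openin X W" "W \<inter> Y \<noteq> {}" for W
  proof (rule ccontr)
    assume no: "\<not> ?thesis"
    obtain Z where Z: "Q Z" "Z \<noteq> {}" "Z \<subseteq> W \<inter> Y"
      using ex[OF W] by auto
    then have "Z \<inter> A = {}" if "A \<in> \<Z>" for A
      using no that by auto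
    then have "disjoint (insert Z \<Z>)"
      using \<Z>(1) by (auto simp: disjoint_def)
    then have "insert Z \<Z> = \<Z>"
      using \<Z>(2) Z bspec[OF max, of "insert Z \<Z>"] by (simp add: subset_insertI)
    then have "Z \<in> \<Z>"
      by (metis insertI1)
    then show False
      using no Z by auto
  qed
  then show thesis
    using that[of \<Z>] \<Z> by simp
qed

text \<open>This is El'kin's lemma.\<close>

lemma split_into_glue:
  assumes "\<And>W. openin X W \<Longrightarrow> W \<inter> Y \<noteq> {} \<Longrightarrow> \<exists>Z. split_into X I Z \<and> Z \<noteq> {} \<and> Z \<subseteq> W \<inter> Y"
  shows "split_into X I Y"
proof -
  obtain \<Z> where \<Z>: "disjoint \<Z>" "\<forall>Z\<in>\<Z>. split_into X I Z \<and> Z \<subseteq> Y"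
    "\<forall>W. openin X W \<longrightarrow> W \<inter> Y \<noteq> {} \<longrightarrow> (\<exists>Z\<in>\<Z>. W \<inter> Z \<noteq> {})"
    by (rule maximal_disjoint_family[OF assms]) (assumption, assumption, rule that)
  from \<Z>(2) have "\<forall>Z\<in>\<Z>. \<exists>C. disjoint_family_on C I \<and> (\<forall>i\<in>I. rel_dense X (C i) Z)"
    by (simp add: split_into_def)
  from bchoice[OF this] obtain C
    where C: "\<forall>Z\<in>\<Z>. disjoint_family_on (C Z) I \<and> (\<forall>i\<in>I. rel_dense X (C Z i) Z)" ..
  then have sub: "C Z i \<subseteq> Z" if "Z \<in> \<Z>" "i \<in> I" for Z i
    using that rel_dense_subset by metis
  define D where "D i = (\<Union>Z\<in>\<Z>. C Z i)" for i
  have "D i \<inter> D j = {}" if ij: "i \<in> I" "j \<in> I" "i \<noteq> j" for i j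
  proof -
    have "C Z i \<inter> C Z' j = {}" if "Z \<in> \<Z>" "Z' \<in> \<Z>" for Z Z'
    proof (cases "Z = Z'")
      case True
      then show ?thesis
        using C that ij by (simp add: disjoint_family_on_def)
    next
      case False
      then have "Z \<inter> Z' = {}"
        using \<Z>(1) that by (simp add: disjoint_def)
      then show ?thesis
        using sub[OF that(1) ij(1)] sub[OF that(2) ij(2)] by auto
    qed
    then show ?thesis
      by (auto simp: D_def)
  qed
  then have "disjoint_family_on D I"
    by (simp add: disjoint_family_on_def)
  moreover have "rel_dense X (D i) Y" if i: "i \<in> I" for i
  proof (rule rel_denseI)
    show "D i \<subseteq> Y"
      using sub i \<Z>(2) by (fastforce simp: D_def)
    fix W assume W: "openin X W" "W \<inter> Y \<noteq> {}"
    then obtain Z where Z: "Z \<in> \<Z>" "W \<inter> Z \<noteq> {}"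
      using \<Z>(3) by auto
    then have "W \<inter> C Z i \<noteq> {}"
      using C i W(1) rel_dense_meets by metis
    then show "W \<inter> D i \<noteq> {}"
      using Z(1) by (auto simp: D_def)
  qed
  ultimately show ?thesis
    unfolding split_into_def by (intro exI[of _ D]) simp
qed

lemma split_into_dense:
  assumes "split_into X I E" "rel_dense X E Y"
  shows "split_into X I Y"
proof -
  obtain C where "disjoint_family_on C I" "\<forall>i\<in>I. rel_dense X (C i) E"
    using assms(1) unfolding split_into_def by (elim exE conjE)
  moreover from this have "\<forall>i\<in>I. rel_dense X (C i) Y"
    using rel_dense_trans[OF _ assms(2)] by simp
  ultimately show ?thesis
    unfolding split_into_def by (intro exI[of _ C]) simp
qed

lemma omega_split_increasing:
  assumes "\<And>n. A n \<subseteq> A (Suc n)" "\<And>n. rel_dense X (A (Suc n) - A n) Y"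
  shows "omega_split X Y"
  unfolding split_into_def using disjoint_family_Suc[of A] assms by auto

text \<open>Otherwise every dense subset of \<open>D\<close> is resolvable on a dense set of places
  and, by gluing, splits into two dense parts. Putting one part aside and splitting the other
  forever produces \<omega> dense parts.\<close>

lemma decisive_somewhere:
  assumes "\<not> omega_split X D" "D \<subseteq> topspace X"
  obtains V E where "openin X V" "V \<inter> D \<noteq> {}" "rel_dense X E (V \<inter> D)" "decisive X E"
proof (rule ccontr)
  assume "\<not> thesis"
  then have contra: "\<not> (openin X V \<and> V \<inter> D \<noteq> {} \<and> rel_dense X E (V \<inter> D) \<and> decisive X E)" for V E
    using that by auto
  have split: "split_into X {0, 1} E" if E: "rel_dense X E D" for E
  proof (rule split_into_glue)
    fix W assume W: "openin X W" "W \<inter> E \<noteq> {}"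
    have "rel_dense X (W \<inter> E) (W \<inter> D)"
      using E W(1) by (rule rel_dense_open)
    moreover have "W \<inter> D \<noteq> {}"
      using W(2) rel_dense_subset[OF E] by auto
    ultimately have "\<not> decisive X (W \<inter> E)"
      using contra[of W "W \<inter> E"] W(1) by simp
    then obtain M W' where W': "openin X W'" "W' \<inter> (W \<inter> E) \<noteq> {}"
      and M: "\<And>V. openin X V \<Longrightarrow> V \<subseteq> W' \<Longrightarrow> V \<inter> (W \<inter> E) \<noteq> {} \<Longrightarrow>
        V \<inter> (W \<inter> E) \<inter> M \<noteq> {} \<and> \<not> V \<inter> (W \<inter> E) \<subseteq> M"
      unfolding decisive_def by metis
    \<comment> \<open>No open part of \<open>W'\<close> decides \<open>M\<close> on
      \<open>W \<inter> E\<close>, so \<open>M\<close> and its complement are both dense in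
      \<open>Z\<close>.\<close>
    define Z where "Z = W' \<inter> (W \<inter> E)"
    have dense: "N \<inter> (Z \<inter> M) \<noteq> {} \<and> N \<inter> (Z - M) \<noteq> {}" if "openin X N" "N \<inter> Z \<noteq> {}" for N
      using M[of "N \<inter> W'"] that W'(1) by (auto simp: Z_def)
    have "split_into X {0, 1} Z"
      unfolding split_into_def
    proof (intro exI conjI ballI)
      show "disjoint_family_on (\<lambda>i. if i = 0 then Z \<inter> M else Z - M) {0, 1}"
        by (auto simp: disjoint_family_on_def)
      show "rel_dense X (if i = 0 then Z \<inter> M else Z - M) Z" for i :: nat
        using dense by (auto simp: rel_dense_def)
    qed
    then show "\<exists>Z. split_into X {0, 1} Z \<and> Z \<noteq> {} \<and> Z \<subseteq> W \<inter> E"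
      using W'(2) by (intro exI[of _ Z]) (auto simp: Z_def)
  qed
  have "\<exists>E. \<forall>n. rel_dense X (E n) D \<and> (E (Suc n) \<subseteq> E n \<and> rel_dense X (E n - E (Suc n)) D)"
  proof (rule dependent_nat_choice)
    show "\<exists>E. rel_dense X E D"
      by (intro exI[of _ D]) (simp add: rel_dense_def)
    fix E assume E: "rel_dense X E D"
    then obtain C where "disjoint_family_on C {0, 1 :: nat}"
      and "\<forall>i\<in>{0, 1}. rel_dense X (C i) E"
      using split unfolding split_into_def by auto
    then have C: "C 0 \<inter> C 1 = {}" "rel_dense X (C 0) E" "rel_dense X (C 1) E"
      by (auto simp: disjoint_family_on_def)
    \<comment> \<open>\<open>C 1\<close> is kept for further splitting; what is put aside contains
      the dense part \<open>C 0\<close>.\<close>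
    have "rel_dense X (E - C 1) E"
      using C(2) by (rule rel_dense_mono) (use C(1) rel_dense_subset[OF C(2)] in auto)
    then have "rel_dense X (C 1) D" "C 1 \<subseteq> E" "rel_dense X (E - C 1) D"
      using C(3) E rel_dense_trans rel_dense_subset by metis+
    then show "\<exists>E'. rel_dense X E' D \<and> E' \<subseteq> E \<and> rel_dense X (E - E') D"
      by auto
  qed
  then obtain E where E: "\<And>n. rel_dense X (E n) D" "\<And>n. E (Suc n) \<subseteq> E n"
    "\<And>n. rel_dense X (E n - E (Suc n)) D"
    by auto
  have "omega_split X D"
  proof (rule omega_split_increasing)
    show "D - E n \<subseteq> D - E (Suc n)" for n
      using E(2) by auto
    have "(D - E (Suc n)) - (D - E n) = E n - E (Suc n)" for n
      using rel_dense_subset[OF E(1)[of n]] by auto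
    then show "rel_dense X ((D - E (Suc n)) - (D - E n)) D" for n
      using E(3) by simp
  qed
  then show False
    using assms by simp
qed

text \<open>The local sets from \<open>decisive_somewhere\<close> are glued over a maximal disjoint
  family of relatively open pieces. Openness of the pieces lets decisiveness carry over: inside one
  piece the union \<open>F\<close> coincides with the local set \<open>E Z\<close>.\<close>

lemma decisive_dense_subset:
  assumes no: "\<And>W. openin X W \<Longrightarrow> W \<inter> Y \<noteq> {} \<Longrightarrow> \<not> omega_split X (W \<inter> Y)"
    and Y: "Y \<subseteq> topspace X"
  obtains E where "rel_dense X E Y" "decisive X E"
proof -
  define Q where "Q Z \<longleftrightarrow> (\<exists>V E. openin X V \<and> Z = V \<inter> Y \<and> rel_dense X E Z \<and> decisive X E)" for Z
  have "\<exists>Z. Q Z \<and> Z \<noteq> {} \<and> Z \<subseteq> W \<inter> Y" if W: "openin X W" "W \<inter> Y \<noteq> {}" for W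
  proof -
    obtain V E where V: "openin X V" "V \<inter> (W \<inter> Y) \<noteq> {}" "rel_dense X E (V \<inter> (W \<inter> Y))" "decisive X E"
      by (rule decisive_somewhere[OF no[OF W]]) (use Y in auto)
    then have "Q (V \<inter> (W \<inter> Y))"
      unfolding Q_def using W(1) by (intro exI[of _ "V \<inter> W"] exI[of _ E]) (simp add: Int_assoc openin_Int)
    then show ?thesis
      using V(2) by auto
  qed
  then obtain \<Z> where \<Z>: "disjoint \<Z>" "\<forall>Z\<in>\<Z>. Q Z \<and> Z \<subseteq> Y"
    "\<forall>W. openin X W \<longrightarrow> W \<inter> Y \<noteq> {} \<longrightarrow> (\<exists>Z\<in>\<Z>. W \<inter> Z \<noteq> {})"
    by (rule maximal_disjoint_family) (assumption, assumption, rule that)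
  have "\<forall>Z\<in>\<Z>. \<exists>E. rel_dense X E Z \<and> decisive X E"
    using \<Z>(2) by (auto simp: Q_def)
  from bchoice[OF this] obtain E where E: "\<forall>Z\<in>\<Z>. rel_dense X (E Z) Z \<and> decisive X (E Z)" ..
  then have sub: "E Z \<subseteq> Z" if "Z \<in> \<Z>" for Z
    using that rel_dense_subset by metis
  define F where "F = (\<Union>Z\<in>\<Z>. E Z)"
  have "rel_dense X F Y"
  proof (rule rel_denseI)
    show "F \<subseteq> Y"
      using sub \<Z>(2) by (fastforce simp: F_def)
    fix W assume W: "openin X W" "W \<inter> Y \<noteq> {}"
    then obtain Z where Z: "Z \<in> \<Z>" "W \<inter> Z \<noteq> {}"
      using \<Z>(3) by auto
    then have "W \<inter> E Z \<noteq> {}"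
      using E W(1) rel_dense_meets by metis
    then show "W \<inter> F \<noteq> {}"
      using Z(1) by (auto simp: F_def)
  qed
  moreover have "decisive X F"
    unfolding decisive_def
  proof (intro allI impI)
    fix M W assume W: "openin X W" "W \<inter> F \<noteq> {}"
    then obtain Z where Z: "Z \<in> \<Z>" "W \<inter> E Z \<noteq> {}"
      by (auto simp: F_def)
    obtain U where U: "openin X U" "Z = U \<inter> Y"
      using \<Z>(2) Z(1) by (auto simp: Q_def)
    have "openin X (W \<inter> U)" "W \<inter> U \<inter> E Z \<noteq> {}"
      using W(1) U Z sub[OF Z(1)] by auto
    then obtain V where V: "openin X V" "V \<subseteq> W \<inter> U" "V \<inter> E Z \<noteq> {}"
      "V \<inter> E Z \<inter> M = {} \<or> V \<inter> E Z \<subseteq> M"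
      using E Z(1) unfolding decisive_def by meson
    have "V \<inter> E Z' = {}" if "Z' \<in> \<Z>" "Z' \<noteq> Z" for Z'
    proof -
      have "Z' \<inter> Z = {}" "Z' \<subseteq> Y"
        using \<Z> Z(1) that by (auto simp: disjoint_def)
      then show ?thesis
        using V(2) U(2) sub[OF that(1)] by fast
    qed
    then have "V \<inter> F = V \<inter> E Z"
      using Z(1) by (auto simp: F_def)
    then show "\<exists>V. openin X V \<and> V \<subseteq> W \<and> V \<inter> F \<noteq> {} \<and> (V \<inter> F \<inter> M = {} \<or> V \<inter> F \<subseteq> M)"
      using V by (intro exI[of _ V]) auto
  qed
  ultimately show thesis
    using that by simp
qed

section \<open>Finite partitions into dense decisive pieces\<close>

definition decisive_partition :: "'a topology \<Rightarrow> 'a set \<Rightarrow> 'a set set \<Rightarrow> bool" where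
  "decisive_partition X Y \<F> \<longleftrightarrow> finite \<F> \<and> disjoint \<F> \<and> \<Union>\<F> = Y \<and>
    (\<forall>D\<in>\<F>. rel_dense X D Y \<and> decisive X D)"

lemma decisive_partition_open:
  assumes \<F>: "finite \<F>" "disjoint \<F>" "\<forall>D\<in>\<F>. rel_dense X D Y \<and> decisive X D" and V: "openin X V"
    and cover: "V \<inter> \<Union>\<F> = V \<inter> Y"
  shows "decisive_partition X (V \<inter> Y) ((\<inter>) V ` \<F>)"
proof -
  have "disjoint ((\<inter>) V ` \<F>)"
    using \<F>(2) by (auto simp: disjoint_def)
  moreover have "\<Union>((\<inter>) V ` \<F>) = V \<inter> Y"
    using cover by auto
  moreover have "rel_dense X (V \<inter> D) (V \<inter> Y) \<and> decisive X (V \<inter> D)" if "D \<in> \<F>" for D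
    using \<F>(3) that rel_dense_open[OF _ V] decisive_open[OF _ V] by simp
  ultimately show ?thesis
    using \<F>(1) by (simp add: decisive_partition_def)
qed

text \<open>Otherwise finitely many disjoint dense decisive sets never exhaust an open part of
  \<open>Y\<close>, so their complement is dense in \<open>Y\<close> and contains one more such set.
  Continuing forever splits \<open>Y\<close> into \<omega> parts.\<close>

lemma decisive_partition_somewhere:
  assumes no: "\<And>W. openin X W \<Longrightarrow> W \<inter> Y \<noteq> {} \<Longrightarrow> \<not> omega_split X (W \<inter> Y)"
    and Y: "Y \<subseteq> topspace X" "Y \<noteq> {}"
  obtains V \<F> where "openin X V" "V \<inter> Y \<noteq> {}" "decisive_partition X (V \<inter> Y) \<F>"
proof (rule ccontr)
  assume "\<not> thesis"
  then have contra: "\<not> (openin X V \<and> V \<inter> Y \<noteq> {} \<and> decisive_partition X (V \<inter> Y) \<F>)" for V \<F>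
    using that by auto
  define H where "H \<G> \<longleftrightarrow> finite \<G> \<and> disjoint \<G> \<and> (\<forall>D\<in>\<G>. rel_dense X D Y \<and> decisive X D)" for \<G>
  have rest: "rel_dense X (Y - \<Union>\<G>) Y" if \<G>: "H \<G>" for \<G>
  proof (rule rel_denseI)
    fix W assume W: "openin X W" "W \<inter> Y \<noteq> {}"
    have sub: "\<Union>\<G> \<subseteq> Y"
      using \<G> rel_dense_subset unfolding H_def by (metis Union_least)
    show "W \<inter> (Y - \<Union>\<G>) \<noteq> {}"
    proof
      assume "W \<inter> (Y - \<Union>\<G>) = {}"
      then have "W \<inter> \<Union>\<G> = W \<inter> Y"
        using sub by auto
      then have "decisive_partition X (W \<inter> Y) ((\<inter>) W ` \<G>)"
        using \<G> W(1) decisive_partition_open[of \<G> X Y W] by (simp add: H_def)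
      then show False
        using contra[of W "(\<inter>) W ` \<G>"] W by simp
    qed
  qed auto
  have "\<exists>G. \<forall>n. H (G n) \<and> (\<Union>(G n) \<subseteq> \<Union>(G (Suc n)) \<and> rel_dense X (\<Union>(G (Suc n)) - \<Union>(G n)) Y)"
  proof (rule dependent_nat_choice)
    show "\<exists>\<G>. H \<G>"
      by (intro exI[of _ "{}"]) (simp add: H_def)
    fix \<G> assume \<G>: "H \<G>"
    let ?R = "Y - \<Union>\<G>"
    have "\<not> omega_split X (W \<inter> ?R)" if W: "openin X W" "W \<inter> ?R \<noteq> {}" for W
    proof
      assume "omega_split X (W \<inter> ?R)"
      then have "omega_split X (W \<inter> Y)"
        using rel_dense_open[OF rest[OF \<G>] W(1)] by (rule split_into_dense)
      moreover have "W \<inter> Y \<noteq> {}"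
        using W(2) by auto
      ultimately show False
        using no W(1) by simp
    qed
    moreover have "?R \<subseteq> topspace X"
      using Y(1) by auto
    ultimately obtain E where E: "rel_dense X E ?R" "decisive X E"
      by (rule decisive_dense_subset)
    have EY: "rel_dense X E Y"
      using E(1) rest[OF \<G>] by (rule rel_dense_trans)
    have ER: "E \<inter> \<Union>\<G> = {}"
      using rel_dense_subset[OF E(1)] by auto
    have "disjoint (insert E \<G>)"
      using \<G> ER by (auto simp: H_def disjoint_def)
    then have "H (insert E \<G>)"
      using \<G> EY E(2) by (simp add: H_def)
    moreover have "\<Union>(insert E \<G>) - \<Union>\<G> = E"
      using ER by auto
    ultimately show "\<exists>\<G>'. H \<G>' \<and> \<Union>\<G> \<subseteq> \<Union>\<G>' \<and> rel_dense X (\<Union>\<G>' - \<Union>\<G>) Y"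
      using EY by (intro exI[of _ "insert E \<G>"]) auto
  qed
  then obtain G where G: "\<forall>n. H (G n) \<and>
      (\<Union>(G n) \<subseteq> \<Union>(G (Suc n)) \<and> rel_dense X (\<Union>(G (Suc n)) - \<Union>(G n)) Y)" ..
  have "omega_split X Y"
    by (rule omega_split_increasing[of "\<lambda>n. \<Union>(G n)"]) (use G in simp_all)
  moreover have "topspace X \<inter> Y = Y"
    using Y(1) by auto
  ultimately show False
    using no[of "topspace X"] Y(2) by simp
qed

text \<open>\<open>P\<close> selects greedily along \<open>R\<close>: a point joins when some
  neighbourhood misses all earlier points of \<open>E\<close> that joined. If an open set met
  \<open>E\<close> but no selected point, each of its points in \<open>E\<close> would join. So the
  selection is dense in \<open>E\<close>, and by decisiveness it contains a nonempty relatively open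
  part.\<close>

lemma decisive_left_separated:
  assumes R: "wf R" and E: "decisive X E" and W: "openin X W" "W \<inter> E \<noteq> {}"
  obtains V where "openin X V" "V \<subseteq> W" "V \<inter> E \<noteq> {}"
    "\<forall>x\<in>V \<inter> E. \<exists>U. openin X U \<and> x \<in> U \<and> (\<forall>y\<in>U \<inter> (V \<inter> E). (y, x) \<notin> R)"
proof -
  obtain P where P: "\<And>x. P x \<longleftrightarrow>
      (\<lambda>x S. \<exists>U. openin X U \<and> x \<in> U \<and> U \<inter> E \<inter> S = {}) x {y. (y, x) \<in> R \<and> P y}"
    using wf_rec_predicate[OF R, of "\<lambda>x S. \<exists>U. openin X U \<and> x \<in> U \<and> U \<inter> E \<inter> S = {}"] by blast
  have meets: "V \<inter> E \<inter> {x. P x} \<noteq> {}" if V: "openin X V" "V \<inter> E \<noteq> {}" for V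
  proof
    assume empty: "V \<inter> E \<inter> {x. P x} = {}"
    obtain x where x: "x \<in> V" "x \<in> E"
      using V(2) by auto
    have "P x"
      unfolding P[of x] using V(1) x(1) empty by (intro exI[of _ V]) auto
    then show False
      using empty x by auto
  qed
  obtain V where V: "openin X V" "V \<subseteq> W" "V \<inter> E \<noteq> {}"
    and "V \<inter> E \<inter> {x. P x} = {} \<or> V \<inter> E \<subseteq> {x. P x}"
    using E W unfolding decisive_def by meson
  then have VP: "V \<inter> E \<subseteq> {x. P x}"
    using meets by auto
  have "\<exists>U. openin X U \<and> x \<in> U \<and> (\<forall>y\<in>U \<inter> (V \<inter> E). (y, x) \<notin> R)" if x: "x \<in> V \<inter> E" for x
  proof -
    have "P x"
      using VP x by auto
    then obtain U where U: "openin X U" "x \<in> U" "U \<inter> E \<inter> {y. (y, x) \<in> R \<and> P y} = {}"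
      unfolding P[of x] by auto
    then show ?thesis
      using VP by (intro exI[of _ U]) auto
  qed
  then show thesis
    using that[of V] V by simp
qed

section \<open>Accumulation points of large sets\<close>

lemma derived_set_of_subset_closed:
  assumes "closedin X K" "A \<subseteq> K"
  shows "X derived_set_of A \<subseteq> K"
  using derived_set_of_mono[OF assms(2), of X] assms(1)
  unfolding closedin_contains_derived_set by (rule subset_trans[OF _ conjunct1])

locale regular_cardinal_space = regular_cardinal \<kappa> for \<kappa> :: "'k rel" +
  fixes X :: "'a topology"
  assumes regular_space: "regular_space X"
    and t1_space: "t1_space X"
begin

lemma closed_neighbourhood:
  assumes "openin X W" "x \<in> W"
  obtains U K where "openin X U" "closedin X K" "x \<in> U" "U \<subseteq> K" "K \<subseteq> W"
proof -
  have "neighbourhood_base_of (closedin X) X"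
    using regular_space by (simp add: neighbourhood_base_of_closedin)
  then show thesis
    using assms that unfolding neighbourhood_base_of by meson
qed

text \<open>For sets of size \<kappa> this is a complete accumulation point. Outside
  \<open>topspace X\<close> the second condition would hold vacuously.\<close>

definition acc_point :: "'a \<Rightarrow> 'a set \<Rightarrow> bool" where
  "acc_point q B \<longleftrightarrow> q \<in> topspace X \<and> (\<forall>W. openin X W \<longrightarrow> q \<in> W \<longrightarrow> large (W \<inter> B))"

text \<open>\<open>S\<close> has size exactly \<kappa>. The witnesses in \<open>P\<close> may lie
  outside \<open>S\<close>; their number is bounded by \<kappa> for the pigeonhole argument on the
  tree.\<close>

definition captured :: "'a set \<Rightarrow> 'a set \<Rightarrow> bool" where
  "captured S P \<longleftrightarrow> moderate S \<and> large S \<and> moderate P \<and> S \<subseteq> topspace X \<and>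
    (\<forall>B\<subseteq>S. large B \<longrightarrow> (\<exists>q\<in>P. acc_point q B))"

lemma acc_pointD: "acc_point q B \<Longrightarrow> openin X W \<Longrightarrow> q \<in> W \<Longrightarrow> large (W \<inter> B)"
  by (simp add: acc_point_def)

lemma acc_point_mono: "acc_point q A \<Longrightarrow> A \<subseteq> B \<Longrightarrow> acc_point q B"
  unfolding acc_point_def using small_mono by (metis Int_mono order_refl)

lemma acc_point_open:
  assumes "acc_point q B" "openin X V" "q \<in> V"
  shows "acc_point q (V \<inter> B)"
  unfolding acc_point_def
proof (intro conjI allI impI)
  fix W assume "openin X W" "q \<in> W"
  then show "large (W \<inter> (V \<inter> B))"
    using acc_pointD[OF assms(1), of "W \<inter> V"] assms(2,3) by (simp add: Int_assoc openin_Int)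
qed (use assms in \<open>simp add: acc_point_def\<close>)

lemma acc_point_closed:
  assumes "acc_point q B" "closedin X K" "B \<subseteq> K"
  shows "q \<in> K"
proof (rule ccontr)
  assume "q \<notin> K"
  then have "large ((topspace X - K) \<inter> B)"
    using assms by (intro acc_pointD) (auto simp: acc_point_def)
  moreover have "(topspace X - K) \<inter> B = {}"
    using assms(3) by auto
  ultimately show False
    by (simp add: countable_imp_small)
qed

lemma captured_subset:
  assumes "captured S P" "T \<subseteq> S" "large T"
  shows "captured T P"
  using assms moderate_mono unfolding captured_def by (meson subset_trans)

lemma captured_imp_acc_point:
  assumes "captured S P"
  obtains q where "q \<in> P" "acc_point q S"
  using assms unfolding captured_def by auto

lemma captured_nonempty: "captured S P \<Longrightarrow> S \<noteq> {}"
  by (rule large_nonempty) (simp add: captured_def)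

text \<open>\<open>disjoint_selection\<close> is applied with accumulation as \<open>Acc\<close>.
  Its set \<open>R\<close> meets every \<open>W\<close> that meets \<open>Z\<close>, and at
  \<open>q \<in> R\<close> each \<open>D q k\<close> differs by a small set from one that is large
  in every neighbourhood of \<open>q\<close>. So every union \<open>C k\<close> is dense.\<close>

lemma omega_split_capturing:
  assumes Z: "moderate Z" and P: "moderate P"
    and cap: "\<And>W. openin X W \<Longrightarrow> W \<inter> Z \<noteq> {} \<Longrightarrow>
      \<exists>S\<subseteq>W \<inter> Z. large S \<and> (\<forall>B\<subseteq>S. large B \<longrightarrow> (\<exists>q\<in>P \<inter> W. acc_point q B))"
  shows "omega_split X Z"
proof -
  obtain R and D :: "'a \<Rightarrow> nat \<Rightarrow> 'a set" where "R \<subseteq> P"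
    and D: "\<forall>q\<in>R. \<forall>k. D q k \<subseteq> Z \<and> (\<exists>B U. acc_point q B \<and> small U \<and> D q k = B - U)"
    and disj: "\<forall>q\<in>R. \<forall>q'\<in>R. \<forall>k k'. (q, k) \<noteq> (q', k') \<longrightarrow> D q k \<inter> D q' k' = {}"
    and R: "\<forall>S P'. S \<subseteq> Z \<longrightarrow> large S \<longrightarrow> P' \<subseteq> P \<longrightarrow>
        (\<forall>B\<subseteq>S. large B \<longrightarrow> (\<exists>q\<in>P'. acc_point q B)) \<longrightarrow> R \<inter> P' \<noteq> {}"
    by (rule disjoint_selection[OF Z P acc_point_mono]) (assumption, assumption, rule that)
  define C where "C k = (\<Union>q\<in>R. D q k)" for k
  have "C i \<inter> C j = {}" if "i \<noteq> j" for i j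
  proof -
    have "D q i \<inter> D q' j = {}" if "q \<in> R" "q' \<in> R" for q q'
      using disj that \<open>i \<noteq> j\<close> by simp
    then show ?thesis
      by (auto simp: C_def)
  qed
  then have "disjoint_family_on C UNIV"
    by (simp add: disjoint_family_on_def)
  moreover have "rel_dense X (C k) Z" for k
  proof (rule rel_denseI)
    show "C k \<subseteq> Z"
      using D by (auto simp: C_def)
    fix W assume W: "openin X W" "W \<inter> Z \<noteq> {}"
    obtain S where S: "S \<subseteq> W \<inter> Z" "large S"
      "\<forall>B\<subseteq>S. large B \<longrightarrow> (\<exists>q\<in>P \<inter> W. acc_point q B)"
      using cap[OF W] by auto
    then have "R \<inter> (P \<inter> W) \<noteq> {}"
      using R[rule_format, of S "P \<inter> W"] by simp
    then obtain q where q: "q \<in> R" "q \<in> W"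
      by auto
    obtain B U where B: "acc_point q B" "small U" "D q k = B - U"
      using D q(1) by meson
    have "large (W \<inter> B - U)"
      using acc_pointD[OF B(1) W(1) q(2)] B(2) by (rule large_Diff)
    then have "W \<inter> D q k \<noteq> {}"
      using large_nonempty[of "W \<inter> B - U"] by (simp add: B(3) Int_Diff)
    then show "W \<inter> C k \<noteq> {}"
      using q(1) by (auto simp: C_def)
  qed
  ultimately show ?thesis
    unfolding split_into_def by (intro exI[of _ C]) simp
qed

text \<open>Regularity of the space keeps witnesses local: a point
  \<open>q \<in> Q \<inter> W\<close> has a closed neighbourhood \<open>K \<subseteq> W\<close>, and
  accumulation points of subsets of \<open>K\<close> stay in \<open>K\<close>.\<close>

lemma omega_split_captured_family:
  assumes Q: "moderate Q" and S: "\<forall>q\<in>Q. captured (S q) (P q) \<and> acc_point q (S q)"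
    and dense: "\<And>W. openin X W \<Longrightarrow> W \<inter> (\<Union>q\<in>Q. S q) \<noteq> {} \<Longrightarrow> W \<inter> Q \<noteq> {}"
  shows "omega_split X (\<Union>q\<in>Q. S q)"
proof (rule omega_split_capturing)
  show "moderate (\<Union>q\<in>Q. S q)" "moderate (\<Union>q\<in>Q. P q)"
    using S by (auto intro!: moderate_UN[OF Q] simp: captured_def)
  fix W assume W: "openin X W" "W \<inter> (\<Union>q\<in>Q. S q) \<noteq> {}"
  then obtain q where q: "q \<in> Q" "q \<in> W"
    using dense[OF W] by auto
  obtain U K where U: "openin X U" "closedin X K" "q \<in> U" "U \<subseteq> K" "K \<subseteq> W"
    using closed_neighbourhood[OF W(1) q(2)] .
  have Sq: "captured (S q) (P q)" "acc_point q (S q)"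
    using S q(1) by simp_all
  have "\<exists>p\<in>(\<Union>q\<in>Q. P q) \<inter> W. acc_point p B" if B: "B \<subseteq> U \<inter> S q" "large B" for B
  proof -
    obtain p where p: "p \<in> P q" "acc_point p B"
      using Sq(1) B unfolding captured_def by auto
    have "p \<in> K"
      by (rule acc_point_closed[OF p(2) U(2)]) (use B U in auto)
    then show ?thesis
      using p q(1) U(5) by auto
  qed
  moreover have "large (U \<inter> S q)"
    using acc_pointD[OF Sq(2) U(1,3)] .
  moreover have "U \<inter> S q \<subseteq> W \<inter> (\<Union>q\<in>Q. S q)"
    using U q(1) by auto
  ultimately show "\<exists>S'\<subseteq>W \<inter> (\<Union>q\<in>Q. S q). large S' \<and>
      (\<forall>B\<subseteq>S'. large B \<longrightarrow> (\<exists>p\<in>(\<Union>q\<in>Q. P q) \<inter> W. acc_point p B))"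
    by (intro exI[of _ "U \<inter> S q"]) simp
qed

text \<open>If every \<open>q \<in> F\<close> had a neighbourhood with small trace on
  \<open>B\<close>, the union of these traces would be small. The rest of \<open>B\<close> would be
  large without a limit point in \<open>F\<close>.\<close>

lemma small_limit_set_captures:
  assumes F: "small F" and A: "moderate A" "large A" "A \<subseteq> topspace X" and top: "F \<subseteq> topspace X"
    and lim: "\<And>B. B \<subseteq> A \<Longrightarrow> large B \<Longrightarrow> F \<inter> X derived_set_of B \<noteq> {}"
  shows "captured A F"
proof -
  have "\<exists>q\<in>F. acc_point q B" if B: "B \<subseteq> A" "large B" for B
  proof (rule ccontr)
    assume "\<not> ?thesis"
    then have "\<forall>q\<in>F. \<exists>U. openin X U \<and> q \<in> U \<and> small (U \<inter> B)"
      using top unfolding acc_point_def by auto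
    from bchoice[OF this] obtain U
      where U: "\<forall>q\<in>F. openin X (U q) \<and> q \<in> U q \<and> small (U q \<inter> B)" ..
    then have "small (\<Union>q\<in>F. U q \<inter> B)"
      by (intro small_UN[OF F]) simp
    then have "large (B - (\<Union>q\<in>F. U q \<inter> B))"
      by (rule large_Diff[OF B(2)])
    then obtain p where p: "p \<in> F" "p \<in> X derived_set_of (B - (\<Union>q\<in>F. U q \<inter> B))"
      using lim[of "B - (\<Union>q\<in>F. U q \<inter> B)"] B(1) by auto
    then show False
      using U by (auto simp: in_derived_set_of)
  qed
  then show ?thesis
    using A small_imp_moderate[OF F] by (simp add: captured_def)
qed

text \<open>The points of \<open>F\<close> with fewer than \<kappa> predecessors form an initial
  segment \<open>S\<close> of size \<kappa>. If a large \<open>A \<subseteq> S\<close> accumulated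
  nowhere in \<open>S\<close>, it could be thinned to a large \<open>B\<close> too sparse to have a
  limit point in \<open>F\<close>.\<close>

lemma left_separated_captured:
  assumes R: "wf R" "trans R" "total R"
    and F: "F \<subseteq> topspace X" "large F"
    and left: "\<forall>x\<in>F. \<exists>U. openin X U \<and> x \<in> U \<and> (\<forall>y\<in>U \<inter> F. (y, x) \<notin> R)"
    and lim: "\<And>B. B \<subseteq> F \<Longrightarrow> large B \<Longrightarrow> F \<inter> X derived_set_of B \<noteq> {}"
  obtains S where "S \<subseteq> F" "captured S S"
proof -
  have irrefl: "(x, x) \<notin> R" for x
    using R(1) wf_not_refl by fast
  have asym: "(x, y) \<in> R \<Longrightarrow> (y, x) \<notin> R" for x y
    using R(1) wf_not_sym by fast
  have tot: "x = y \<or> (x, y) \<in> R \<or> (y, x) \<in> R" for x y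
    using R(3) by (auto simp: total_on_def)
  define pred where "pred x = {y \<in> F. (y, x) \<in> R}" for x
  define S where "S = {x \<in> F. small (pred x)}"
  have pred_mono: "pred x \<subseteq> pred y" if "(x, y) \<in> R" for x y
    using that transD[OF R(2)] by (auto simp: pred_def)
  have below: "(y, x) \<in> R" if "x \<in> F" "x \<notin> S" "y \<in> S" for x y
  proof (rule ccontr)
    assume "(y, x) \<notin> R"
    then have "pred x \<subseteq> pred y"
      using tot[of x y] that pred_mono by auto
    then show False
      using that small_mono[of "pred y" "pred x"] by (simp add: S_def)
  qed
  \<comment> \<open>Otherwise the least point of \<open>F\<close> outside \<open>S\<close> would
    have all its predecessors in \<open>S\<close> and thus belong to \<open>S\<close>.\<close>
  have "large S"
  proof
    assume S: "small S"
    then have "large (F - S)"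
      by (rule large_Diff[OF F(2)])
    then obtain z where "z \<in> F - S"
      using large_nonempty by (metis ex_in_conv)
    then obtain x where x: "x \<in> F - S" "\<forall>y. (y, x) \<in> R \<longrightarrow> y \<notin> F - S"
      using wfE_min[OF R(1)] by metis
    then have "pred x \<subseteq> S"
      by (auto simp: pred_def)
    then show False
      using x(1) small_mono[OF S] by (simp add: S_def)
  qed
  have "moderate S"
  proof (rule ccontr)
    assume S: "\<not> moderate S"
    obtain T where T: "T \<subseteq> S" "moderate T" "large T"
      using large_imp_moderate_large_subset[OF \<open>large S\<close>] .
    have "moderate (\<Union>t\<in>T. insert t (pred t))"
    proof (rule moderate_UN[OF T(2)])
      fix t assume "t \<in> T"
      then have "small (pred t)"
        using T(1) by (auto simp: S_def)
      then show "moderate (insert t (pred t))"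
        using moderate_Un[of "{t}" "pred t"]
        by (simp add: small_imp_moderate countable_imp_small)
    qed
    then have "\<not> S \<subseteq> (\<Union>t\<in>T. insert t (pred t))"
      using S moderate_mono by metis
    then obtain x where x: "x \<in> S" "x \<notin> (\<Union>t\<in>T. insert t (pred t))"
      by auto
    have "T \<subseteq> pred x"
    proof
      fix t assume t: "t \<in> T"
      then have "x \<noteq> t" "(x, t) \<notin> R"
        using x by (auto simp: pred_def S_def)
      then show "t \<in> pred x"
        using tot[of x t] t T(1) by (auto simp: pred_def S_def)
    qed
    moreover have "small (pred x)"
      using x(1) by (simp add: S_def)
    ultimately show False
      using T(3) small_mono by metis
  qed
  have acc: "\<exists>q\<in>S. acc_point q A" if A: "A \<subseteq> S" "large A" for A
  proof (rule ccontr)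
    assume no: "\<not> ?thesis"
    have "\<exists>U. openin X U \<and> q \<in> U \<and> small (U \<inter> A) \<and> (\<forall>y\<in>U \<inter> F. (y, q) \<notin> R)" if q: "q \<in> S" for q
    proof -
      have qF: "q \<in> F" "q \<in> topspace X"
        using q F(1) by (auto simp: S_def)
      obtain U where U: "openin X U" "q \<in> U" "small (U \<inter> A)"
        using no q qF(2) unfolding acc_point_def by auto
      obtain V where V: "openin X V" "q \<in> V" "\<forall>y\<in>V \<inter> F. (y, q) \<notin> R"
        using bspec[OF left qF(1)] by auto
      have "small (U \<inter> V \<inter> A)"
        using U(3) by (rule small_mono) auto
      then show ?thesis
        using U V by (intro exI[of _ "U \<inter> V"]) auto
    qed
    then have "\<forall>q\<in>S. \<exists>U. openin X U \<and> q \<in> U \<and> small (U \<inter> A) \<and> (\<forall>y\<in>U \<inter> F. (y, q) \<notin> R)"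
      by simp
    from bchoice[OF this] obtain U where U: "\<forall>q\<in>S. openin X (U q) \<and> q \<in> U q \<and>
        small (U q \<inter> A) \<and> (\<forall>y\<in>U q \<inter> F. (y, q) \<notin> R)" ..
    define upto where "upto b = {q \<in> S. q = b \<or> (q, b) \<in> R}" for b
    \<comment> \<open>Greedy thinning: \<open>b\<close> is kept when it avoids \<open>U q\<close>
      for all \<open>q\<close> up to any earlier kept point of \<open>A\<close>.\<close>
    obtain P where P: "\<And>b. P b \<longleftrightarrow>
        (\<lambda>b L. \<forall>b'\<in>L \<inter> A. \<forall>q\<in>upto b'. b \<notin> U q) b {b'. (b', b) \<in> R \<and> P b'}"
      using wf_rec_predicate[OF R(1), of "\<lambda>b L. \<forall>b'\<in>L \<inter> A. \<forall>q\<in>upto b'. b \<notin> U q"] by blast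
    define B where "B = {b \<in> A. P b}"
    have apart: "b' \<notin> U q" if "b \<in> B" "b' \<in> B" "(b, b') \<in> R" "q \<in> upto b" for b b' q
    proof -
      have "\<forall>b''\<in>{b''. (b'', b') \<in> R \<and> P b''} \<inter> A. \<forall>q\<in>upto b''. b' \<notin> U q"
        using that(2) P[of b'] by (simp add: B_def)
      moreover have "b \<in> {b''. (b'', b') \<in> R \<and> P b''} \<inter> A"
        using that(1,3) by (simp add: B_def)
      ultimately show ?thesis
        using that(4) by simp
    qed
    \<comment> \<open>A point is rejected only if it lies in one of the traces collected in
      \<open>G\<close>. A small \<open>B\<close> would make \<open>G\<close> small, leaving a large
      part of \<open>A\<close> to be kept.\<close>
    have "large B"
    proof
      assume B: "small B"
      define G where "G = (\<Union>b\<in>B. \<Union>q\<in>upto b. U q \<inter> A)"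
      have "small (upto b)" if "b \<in> B" for b
      proof -
        have "small (pred b)"
          using that A(1) by (auto simp: B_def S_def)
        then have "small ({b} \<union> pred b)"
          by (rule small_Un[rotated]) (simp add: countable_imp_small)
        then show ?thesis
          by (rule small_mono) (auto simp: upto_def pred_def S_def)
      qed
      then have "small G"
        unfolding G_def using U by (intro small_UN[OF B] small_UN) (auto simp: upto_def)
      moreover have "A - G \<subseteq> B"
      proof
        fix a assume a: "a \<in> A - G"
        have "P a"
          unfolding P[of a] using a by (auto simp: G_def B_def)
        then show "a \<in> B"
          using a by (simp add: B_def)
      qed
      ultimately show False
        using A(2) large_Diff[of A G] small_mono[OF B] by metis
    qed
    moreover have BS: "B \<subseteq> S"
      using A(1) by (auto simp: B_def)
    moreover have "S \<subseteq> F"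
      by (auto simp: S_def)
    ultimately obtain p where p: "p \<in> F" "p \<in> X derived_set_of B"
      using lim[of B] by auto
    \<comment> \<open>All of \<open>S\<close> precedes a point of \<open>F - S\<close>, whose
      separating neighbourhood therefore misses \<open>B\<close>.\<close>
    have "p \<in> S"
    proof (rule ccontr)
      assume pS: "p \<notin> S"
      obtain V where V: "openin X V" "p \<in> V" "\<forall>y\<in>V \<inter> F. (y, p) \<notin> R"
        using bspec[OF left p(1)] by auto
      then obtain y where "y \<in> B" "y \<in> V"
        using p(2) by (auto simp: in_derived_set_of)
      then show False
        using below[OF p(1) pS, of y] V(3) BS \<open>S \<subseteq> F\<close> by auto
    qed
    then have Up: "openin X (U p)" "p \<in> U p" "\<forall>y\<in>U p \<inter> F. (y, p) \<notin> R"
      using U by simp_all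
    then obtain b where b: "b \<noteq> p" "b \<in> B" "b \<in> U p"
      using p(2) by (auto simp: in_derived_set_of)
    have "b \<in> topspace X"
      using b(2) BS \<open>S \<subseteq> F\<close> F(1) by auto
    \<comment> \<open>T1 yields a second point \<open>c\<close> of \<open>B\<close> in
      \<open>U p\<close>. Neither \<open>b\<close> nor \<open>c\<close> precedes \<open>p\<close>,
      so \<open>p\<close> lies in \<open>upto b\<close> and in \<open>upto c\<close>, and the later
      of the two points should have avoided \<open>U p\<close>.\<close>
    then have "openin X (U p - {b})"
      using Up(1) t1_space by (intro openin_diff closedin_t1_singleton)
    then obtain c where c: "c \<noteq> p" "c \<in> B" "c \<in> U p" "c \<noteq> b"
      using p(2) Up(2) b(1) unfolding in_derived_set_of by (metis DiffE DiffI insertCI singletonD)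
    have "p \<in> upto b" "p \<in> upto c"
      using b c Up(3) tot[of p b] tot[of p c] \<open>p \<in> S\<close> BS \<open>S \<subseteq> F\<close> by (auto simp: upto_def)
    then show False
      using tot[of b c] apart[of b c p] apart[of c b p] b c by auto
  qed
  have "captured S S"
    unfolding captured_def using \<open>large S\<close> \<open>moderate S\<close> acc F(1) by (auto simp: S_def)
  then show thesis
    using that[of S] by (auto simp: S_def)
qed

section \<open>The two cardinal hypotheses for subsets of the space\<close>

definition big :: "'a set \<Rightarrow> bool" where
  "big Y \<longleftrightarrow> (\<forall>W. openin X W \<longrightarrow> W \<inter> Y \<noteq> {} \<longrightarrow> large (W \<inter> Y))"

text \<open>
  The condition on the extent is localized so that it passes to relatively open subsets.
\<close>

definition admissible :: "'a set \<Rightarrow> bool" where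
  "admissible Y \<longleftrightarrow> Y \<subseteq> topspace X \<and> Y \<noteq> {} \<and> big Y \<and>
    (\<forall>x\<in>Y. \<exists>U. openin X U \<and> x \<in> U \<and> (\<forall>A\<subseteq>U \<inter> Y. large A \<longrightarrow> Y \<inter> X derived_set_of A \<noteq> {}))"

lemma bigD: "big Y \<Longrightarrow> openin X W \<Longrightarrow> W \<inter> Y \<noteq> {} \<Longrightarrow> large (W \<inter> Y)"
  by (simp add: big_def)

lemma big_open:
  assumes "big Y" "openin X V"
  shows "big (V \<inter> Y)"
  unfolding big_def
proof (intro allI impI)
  fix W assume "openin X W" "W \<inter> (V \<inter> Y) \<noteq> {}"
  then show "large (W \<inter> (V \<inter> Y))"
    using bigD[OF assms(1), of "W \<inter> V"] assms(2) by (simp add: Int_assoc openin_Int)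
qed

text \<open>The closed set \<open>K\<close> traps the limit points of its subsets inside
  \<open>W\<close>, so that the limit condition can be used within \<open>W\<close>.\<close>

lemma admissible_neighbourhood:
  assumes Y: "admissible Y" and W: "openin X W" and x: "x \<in> W" "x \<in> Y"
  obtains U K where "openin X U" "closedin X K" "x \<in> U" "U \<subseteq> K" "K \<subseteq> W"
    "\<forall>A\<subseteq>K \<inter> Y. large A \<longrightarrow> Y \<inter> X derived_set_of A \<noteq> {}"
proof -
  obtain V where V: "openin X V" "x \<in> V" "\<forall>A\<subseteq>V \<inter> Y. large A \<longrightarrow> Y \<inter> X derived_set_of A \<noteq> {}"
    using Y x(2) unfolding admissible_def by meson
  have "openin X (V \<inter> W)" "x \<in> V \<inter> W"
    using V W x by auto
  then obtain U K where U: "openin X U" "closedin X K" "x \<in> U" "U \<subseteq> K" "K \<subseteq> V \<inter> W"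
    by (rule closed_neighbourhood)
  have "\<forall>A\<subseteq>K \<inter> Y. large A \<longrightarrow> Y \<inter> X derived_set_of A \<noteq> {}"
  proof (intro allI impI)
    fix A assume "A \<subseteq> K \<inter> Y" "large A"
    moreover from this have "A \<subseteq> V \<inter> Y"
      using U(5) by auto
    ultimately show "Y \<inter> X derived_set_of A \<noteq> {}"
      using V(3) by simp
  qed
  then show thesis
    using that U by simp
qed

lemma admissible_open:
  assumes Y: "admissible Y" and V: "openin X V" "V \<inter> Y \<noteq> {}"
  shows "admissible (V \<inter> Y)"
proof -
  have "\<exists>U. openin X U \<and> x \<in> U \<and>
      (\<forall>A\<subseteq>U \<inter> (V \<inter> Y). large A \<longrightarrow> V \<inter> Y \<inter> X derived_set_of A \<noteq> {})" if x: "x \<in> V \<inter> Y" for x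
  proof -
    have "x \<in> V" "x \<in> Y"
      using x by simp_all
    then obtain U K where U: "openin X U" "closedin X K" "x \<in> U" "U \<subseteq> K" "K \<subseteq> V"
      and lim: "\<forall>A\<subseteq>K \<inter> Y. large A \<longrightarrow> Y \<inter> X derived_set_of A \<noteq> {}"
      by (rule admissible_neighbourhood[OF Y V(1)])
    have "V \<inter> Y \<inter> X derived_set_of A \<noteq> {}" if A: "A \<subseteq> U \<inter> (V \<inter> Y)" "large A" for A
    proof -
      have "A \<subseteq> K \<inter> Y" "A \<subseteq> K"
        using A(1) U(4) by auto
      then show ?thesis
        using lim[rule_format, of A] A(2) derived_set_of_subset_closed[OF U(2), of A] U(5) by auto
    qed
    then show ?thesis
      using U(1,3) by (intro exI[of _ U]) simp
  qed
  moreover have "V \<inter> Y \<subseteq> topspace X" "big (V \<inter> Y)"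
    using Y big_open[OF _ V(1)] by (auto simp: admissible_def)
  ultimately show ?thesis
    using V(2) by (simp add: admissible_def)
qed

end

section \<open>Partitions into the least number of decisive sets\<close>

text \<open>A setting to be refuted. Minimality ranges over the admissible subsets of
  \<open>Y\<close>, since a proper subfamily of \<open>\<F>\<close> partitions only a part of
  \<open>Y\<close>.\<close>

locale minimal_decisive_partition = regular_cardinal_space \<kappa> X
  for \<kappa> :: "'k rel" and X :: "'a topology" +
  fixes Y :: "'a set" and \<F> :: "'a set set"
  assumes admissible: "admissible Y"
    and partition: "decisive_partition X Y \<F>"
    and minimal: "\<And>Y' \<F>'. Y' \<subseteq> Y \<Longrightarrow> admissible Y' \<Longrightarrow> decisive_partition X Y' \<F>' \<Longrightarrow>
      card \<F> \<le> card \<F>'"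
    and unsplit: "\<And>Z. Z \<subseteq> Y \<Longrightarrow> Z \<noteq> {} \<Longrightarrow> \<not> omega_split X Z"
begin

lemma Y_props: "Y \<subseteq> topspace X" "Y \<noteq> {}" "big Y"
  using admissible by (simp_all add: admissible_def)

lemma partitionD: "finite \<F>" "\<Union>\<F> = Y" "D \<in> \<F> \<Longrightarrow> rel_dense X D Y" "D \<in> \<F> \<Longrightarrow> decisive X D"
  using partition by (simp_all add: decisive_partition_def)

text \<open>By minimality, the union of a proper subfamily of \<open>\<F>\<close> is nowhere admissible.\<close>

lemma escaping_set:
  assumes \<G>: "\<G> \<subset> \<F>" and W: "openin X W" "W \<inter> \<Union>\<G> \<noteq> {}" and big: "big (W \<inter> \<Union>\<G>)"
  obtains A K where "A \<subseteq> \<Union>\<G>" "large A" "closedin X K" "A \<subseteq> K" "K \<subseteq> W"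
    "\<forall>B\<subseteq>K \<inter> Y. large B \<longrightarrow> Y \<inter> X derived_set_of B \<noteq> {}"
    "X derived_set_of A \<inter> \<Union>\<G> = {}"
proof -
  have GY: "\<Union>\<G> \<subseteq> Y"
    using \<G> partitionD(2) by auto
  have "rel_dense X D (\<Union>\<G>)" if D: "D \<in> \<G>" for D
  proof (rule rel_denseI)
    fix V assume V: "openin X V" "V \<inter> \<Union>\<G> \<noteq> {}"
    then have "V \<inter> Y \<noteq> {}"
      using GY by auto
    then show "V \<inter> D \<noteq> {}"
      using rel_dense_meets[OF partitionD(3) V(1)] D \<G> by auto
  qed (use D in auto)
  then have "\<forall>D\<in>\<G>. rel_dense X D (\<Union>\<G>) \<and> decisive X D"
    using \<G> partitionD(4) by auto
  moreover have "disjoint \<G>" "finite \<G>"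
    using \<G> partition pairwise_subset[of disjnt \<F> \<G>] finite_subset[of \<G> \<F>]
    by (auto simp: decisive_partition_def)
  ultimately have "decisive_partition X (W \<inter> \<Union>\<G>) ((\<inter>) W ` \<G>)"
    using W(1) by (intro decisive_partition_open) simp_all
  moreover have "card ((\<inter>) W ` \<G>) < card \<F>"
    using card_image_le[of \<G> "(\<inter>) W"] psubset_card_mono[OF partitionD(1) \<G>]
      finite_subset[of \<G>, OF _ partitionD(1)] \<G> by auto
  moreover have "W \<inter> \<Union>\<G> \<subseteq> Y"
    using GY by auto
  ultimately have "\<not> admissible (W \<inter> \<Union>\<G>)"
    using minimal[of "W \<inter> \<Union>\<G>" "(\<inter>) W ` \<G>"] by auto
  moreover have "W \<inter> \<Union>\<G> \<subseteq> topspace X"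
    using GY Y_props(1) by auto
  \<comment> \<open>The set is nonempty and \<open>big\<close>, so only the limit condition can
    fail, and it does so near some \<open>x\<close>.\<close>
  ultimately obtain x where x: "x \<in> W \<inter> \<Union>\<G>" and bad: "\<forall>U. openin X U \<longrightarrow> x \<in> U \<longrightarrow>
      (\<exists>A\<subseteq>U \<inter> (W \<inter> \<Union>\<G>). large A \<and> W \<inter> \<Union>\<G> \<inter> X derived_set_of A = {})"
    using W(2) big unfolding admissible_def by auto
  have "x \<in> W" "x \<in> Y"
    using x GY by auto
  then obtain U K where U: "openin X U" "closedin X K" "x \<in> U" "U \<subseteq> K" "K \<subseteq> W"
    "\<forall>B\<subseteq>K \<inter> Y. large B \<longrightarrow> Y \<inter> X derived_set_of B \<noteq> {}"
    by (rule admissible_neighbourhood[OF admissible W(1)])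
  obtain A where A: "A \<subseteq> U \<inter> (W \<inter> \<Union>\<G>)" "large A" "W \<inter> \<Union>\<G> \<inter> X derived_set_of A = {}"
    using bad U(1,3) by meson
  have AK: "A \<subseteq> K"
    using A(1) U(4) by auto
  \<comment> \<open>Limit points of \<open>A\<close> lie in \<open>K \<subseteq> W\<close>, so
    missing the union within \<open>W\<close> means missing it altogether.\<close>
  have "X derived_set_of A \<inter> \<Union>\<G> = {}"
    using derived_set_of_subset_closed[OF U(2) AK] U(5) A(3) by auto
  moreover have "A \<subseteq> \<Union>\<G>"
    using A(1) by auto
  ultimately show thesis
    using that A(2) U(2) AK U(5,6) by simp
qed

text \<open>Were the other blocks small on \<open>W\<close>, then \<open>D\<close> would be large on
  all open parts there, and escaping sets of \<open>D\<close> would have their limit points in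
  \<open>Y\<close> inside the small set \<open>T\<close>. Such limit sets capture, so the points of
  \<open>T\<close> where captured sets accumulate are dense, and the union of moderately many
  captured sets splits. The result makes the remaining blocks \<open>big\<close>, as
  \<open>escaping_set\<close> demands.\<close>

lemma large_other_blocks:
  assumes D: "D \<in> \<F>" "\<F> \<noteq> {D}" and W: "openin X W" "W \<inter> Y \<noteq> {}"
  shows "large (W \<inter> \<Union>(\<F> - {D}))"
proof
  define T where "T = W \<inter> \<Union>(\<F> - {D})"
  assume "small (W \<inter> \<Union>(\<F> - {D}))"
  then have T: "small T"
    by (simp add: T_def)
  have YT: "W \<inter> Y \<subseteq> D \<union> T"
    using partitionD(2) by (auto simp: T_def)
  have DY: "D \<subseteq> Y"
    using D(1) partitionD(2) by auto
  have large_D: "large (V \<inter> D)" if V: "openin X V" "V \<subseteq> W" "V \<inter> D \<noteq> {}" for V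
  proof
    assume "small (V \<inter> D)"
    then have "small (V \<inter> D \<union> T)"
      using T by (rule small_Un)
    then have "small (V \<inter> Y)"
      by (rule small_mono) (use YT V(2) in auto)
    moreover have "V \<inter> Y \<noteq> {}"
      using V(3) DY by auto
    ultimately show False
      using bigD[OF Y_props(3) V(1)] by simp
  qed
  define Q where "Q = {q \<in> T. \<exists>S P. S \<subseteq> W \<inter> Y \<and> captured S P \<and> acc_point q S}"
  have dense: "V \<inter> Q \<noteq> {}" if V: "openin X V" "V \<subseteq> W" "V \<inter> Y \<noteq> {}" for V
  proof -
    have G: "{D} \<subset> \<F>"
      using D by auto
    have VD: "V \<inter> \<Union>{D} \<noteq> {}"
      using rel_dense_meets[OF partitionD(3)[OF D(1)] V(1,3)] by simp
    have VD_big: "big (V \<inter> \<Union>{D})"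
      unfolding big_def
    proof (intro allI impI)
      fix N assume N: "openin X N" "N \<inter> (V \<inter> \<Union>{D}) \<noteq> {}"
      then show "large (N \<inter> (V \<inter> \<Union>{D}))"
        using large_D[of "N \<inter> V"] V by (simp add: Int_assoc openin_Int le_infI2)
    qed
    obtain A K where A: "A \<subseteq> \<Union>{D}" "large A" "closedin X K" "A \<subseteq> K" "K \<subseteq> V"
      "\<forall>B\<subseteq>K \<inter> Y. large B \<longrightarrow> Y \<inter> X derived_set_of B \<noteq> {}"
      "X derived_set_of A \<inter> \<Union>{D} = {}"
      by (rule escaping_set[OF G V(1) VD VD_big])
    obtain A' where A': "A' \<subseteq> A" "moderate A'" "large A'"
      using large_imp_moderate_large_subset[OF A(2)] .
    define F where "F = Y \<inter> X derived_set_of A"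
    have FV: "F \<subseteq> V"
      using derived_set_of_subset_closed[OF A(3,4)] A(5) by (auto simp: F_def)
    then have FT: "F \<subseteq> T"
      using A(7) YT V(2) by (auto simp: F_def)
    have A'Y: "A' \<subseteq> V \<inter> Y"
      using A' A(1,4,5) DY by auto
    have "captured A' F"
    proof (rule small_limit_set_captures)
      show "small F"
        using T FT by (rule small_mono)
      show "A' \<subseteq> topspace X" "F \<subseteq> topspace X"
        using A'Y Y_props(1) by (auto simp: F_def)
      show "F \<inter> X derived_set_of B \<noteq> {}" if B: "B \<subseteq> A'" "large B" for B
      proof -
        have "B \<subseteq> K \<inter> Y" "B \<subseteq> A"
          using B(1) A' A'Y A(4) by auto
        then show ?thesis
          using A(6)[rule_format, of B] B(2) derived_set_of_mono[of B A X] by (auto simp: F_def)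
      qed
    qed (rule A')+
    moreover from this obtain q where "q \<in> F" "acc_point q A'"
      by (rule captured_imp_acc_point)
    moreover have "A' \<subseteq> W \<inter> Y"
      using A'Y V(2) by auto
    ultimately have "q \<in> V \<inter> Q"
      using FV FT by (auto simp: Q_def)
    then show ?thesis
      by auto
  qed
  have "\<forall>q\<in>Q. \<exists>S. \<exists>P. S \<subseteq> W \<inter> Y \<and> captured S P \<and> acc_point q S"
    by (auto simp: Q_def)
  from bchoice[OF this] obtain S where "\<forall>q\<in>Q. \<exists>P. S q \<subseteq> W \<inter> Y \<and> captured (S q) P \<and> acc_point q (S q)" ..
  from bchoice[OF this] obtain P
    where S: "\<forall>q\<in>Q. S q \<subseteq> W \<inter> Y \<and> captured (S q) (P q) \<and> acc_point q (S q)" ..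
  define Z where "Z = (\<Union>q\<in>Q. S q)"
  have Z: "Z \<subseteq> W \<inter> Y"
    using S by (auto simp: Z_def)
  have "omega_split X Z"
    unfolding Z_def
  proof (rule omega_split_captured_family)
    have "small Q"
      using T by (rule small_mono) (auto simp: Q_def)
    then show "moderate Q"
      by (rule small_imp_moderate)
    show "\<forall>q\<in>Q. captured (S q) (P q) \<and> acc_point q (S q)"
      using S by simp
    fix V assume "openin X V" "V \<inter> (\<Union>q\<in>Q. S q) \<noteq> {}"
    then have "openin X (V \<inter> W)" "V \<inter> W \<inter> Y \<noteq> {}"
      using Z W(1) by (auto simp: Z_def)
    then show "V \<inter> Q \<noteq> {}"
      using dense[of "V \<inter> W"] by auto
  qed
  moreover have "Z \<noteq> {}"
  proof -
    obtain q where q: "q \<in> Q"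
      using dense[OF W(1) _ W(2)] by auto
    then have "S q \<noteq> {}"
      using S captured_nonempty by metis
    then show ?thesis
      using q by (auto simp: Z_def)
  qed
  ultimately show False
    using unsplit[of Z] Z by auto
qed

text \<open>The witnesses are forced into \<open>D\<close> by starting from a large set in the other
  blocks whose limit points avoid these blocks: its limit points in \<open>Y\<close> must lie in
  \<open>D\<close>.\<close>

lemma captured_in_block:
  assumes D: "D \<in> \<F>" and W: "openin X W" "W \<inter> Y \<noteq> {}"
  obtains S P where "S \<subseteq> W \<inter> Y" "P \<subseteq> W \<inter> D" "captured S P"
proof -
  have DY: "D \<subseteq> Y"
    using D partitionD(2) by auto
  obtain R :: "('a \<times> 'a) set" where R: "wf R" "trans R" "total R"
  proof -
    obtain r :: "('a \<times> 'a) set" where r: "well_order_on UNIV r"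
      using well_order_on ..
    have r': "wf (r - Id)" "trans r" "antisym r" "total r"
      using r by (auto simp: well_order_on_def linear_order_on_def partial_order_on_def
          preorder_on_def)
    show thesis
      using that[of "r - Id"] r'(1,4) trans_diff_Id[OF r'(2,3)] by simp
  qed
  have "W \<inter> D \<noteq> {}"
    using rel_dense_meets[OF partitionD(3)[OF D] W] .
  then obtain V where V: "openin X V" "V \<subseteq> W" "V \<inter> D \<noteq> {}"
    and left: "\<forall>x\<in>V \<inter> D. \<exists>U. openin X U \<and> x \<in> U \<and> (\<forall>y\<in>U \<inter> (V \<inter> D). (y, x) \<notin> R)"
    by (rule decisive_left_separated[OF R(1) partitionD(4)[OF D] W(1)])
  \<comment> \<open>A small \<open>F\<close> captures a part of \<open>A\<close>; a large
    \<open>F\<close> is left separated and contains a set that captures itself.\<close>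
  have *: "\<exists>S P. S \<subseteq> W \<inter> Y \<and> P \<subseteq> W \<inter> D \<and> captured S P"
    if F: "F \<subseteq> V \<inter> D" and lim_F: "\<forall>B\<subseteq>F. large B \<longrightarrow> F \<inter> X derived_set_of B \<noteq> {}"
      and A: "A \<subseteq> V \<inter> Y" "large A" and lim_A: "\<forall>B\<subseteq>A. large B \<longrightarrow> F \<inter> X derived_set_of B \<noteq> {}"
    for F A
  proof (cases "small F")
    case True
    obtain A' where A': "A' \<subseteq> A" "moderate A'" "large A'"
      using large_imp_moderate_large_subset[OF A(2)] .
    have "captured A' F"
    proof (rule small_limit_set_captures[OF True A'(2,3)])
      show "A' \<subseteq> topspace X" "F \<subseteq> topspace X"
        using A' A F V(2) DY Y_props(1) by auto
      show "F \<inter> X derived_set_of B \<noteq> {}" if "B \<subseteq> A'" "large B" for B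
        using lim_A that A'(1) by simp
    qed
    moreover have "A' \<subseteq> W \<inter> Y" "F \<subseteq> W \<inter> D"
      using A' A F V(2) by auto
    ultimately show ?thesis
      by auto
  next
    case False
    have top: "F \<subseteq> topspace X"
      using F DY Y_props(1) by auto
    have "\<exists>U. openin X U \<and> x \<in> U \<and> (\<forall>y\<in>U \<inter> F. (y, x) \<notin> R)" if x: "x \<in> F" for x
    proof -
      have "x \<in> V \<inter> D"
        using x F by auto
      then obtain U where "openin X U" "x \<in> U" "\<forall>y\<in>U \<inter> (V \<inter> D). (y, x) \<notin> R"
        using left by meson
      then show ?thesis
        using F by (intro exI[of _ U]) auto
    qed
    then have "\<forall>x\<in>F. \<exists>U. openin X U \<and> x \<in> U \<and> (\<forall>y\<in>U \<inter> F. (y, x) \<notin> R)"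
      by simp
    then obtain S where "S \<subseteq> F" "captured S S"
      by (rule left_separated_captured[OF R top False]) (use lim_F in simp)
    then show ?thesis
      using F V(2) DY by (intro exI[of _ S]) auto
  qed
  have "\<exists>S P. S \<subseteq> W \<inter> Y \<and> P \<subseteq> W \<inter> D \<and> captured S P"
  \<comment> \<open>With a single block there are no other blocks to start from. A closed piece
    \<open>K \<inter> Y\<close> contains limit points of all its large subsets and serves both as
    \<open>F\<close> and as \<open>A\<close>.\<close>
  proof (cases "\<F> = {D}")
    case True
    then have "D = Y"
      using partitionD(2) by simp
    obtain x where "x \<in> V" "x \<in> Y"
      using V(3) DY by auto
    then obtain U K where U: "openin X U" "closedin X K" "x \<in> U" "U \<subseteq> K" "K \<subseteq> V"
      and lim: "\<forall>B\<subseteq>K \<inter> Y. large B \<longrightarrow> Y \<inter> X derived_set_of B \<noteq> {}"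
      by (rule admissible_neighbourhood[OF admissible V(1)])
    have "large (U \<inter> Y)"
      using bigD[OF Y_props(3) U(1)] U(3) \<open>x \<in> Y\<close> by auto
    moreover have "U \<inter> Y \<subseteq> K \<inter> Y"
      using U(4) by auto
    ultimately have "large (K \<inter> Y)"
      using small_mono by metis
    moreover have "\<forall>B\<subseteq>K \<inter> Y. large B \<longrightarrow> K \<inter> Y \<inter> X derived_set_of B \<noteq> {}"
    proof (intro allI impI)
      fix B assume B: "B \<subseteq> K \<inter> Y" "large B"
      have "X derived_set_of B \<subseteq> K"
        by (rule derived_set_of_subset_closed[OF U(2)]) (use B in auto)
      then show "K \<inter> Y \<inter> X derived_set_of B \<noteq> {}"
        using lim[rule_format, OF B] by auto
    qed
    moreover have "K \<inter> Y \<subseteq> V \<inter> D" "K \<inter> Y \<subseteq> V \<inter> Y"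
      using U(5) \<open>D = Y\<close> by auto
    ultimately show ?thesis
      using *[of "K \<inter> Y" "K \<inter> Y"] by simp
  next
    case False
    have others: "large (N \<inter> \<Union>(\<F> - {D}))" if "openin X N" "N \<inter> Y \<noteq> {}" for N
      using large_other_blocks[OF D False that] .
    have GY: "\<Union>(\<F> - {D}) \<subseteq> Y"
      using partitionD(2) by auto
    have "V \<inter> Y \<noteq> {}"
      using V(3) DY by auto
    then have ne: "V \<inter> \<Union>(\<F> - {D}) \<noteq> {}"
      by (rule large_nonempty[OF others[OF V(1)]])
    have VG_big: "big (V \<inter> \<Union>(\<F> - {D}))"
      unfolding big_def
    proof (intro allI impI)
      fix N assume N: "openin X N" "N \<inter> (V \<inter> \<Union>(\<F> - {D})) \<noteq> {}"
      then have "openin X (N \<inter> V)" "N \<inter> V \<inter> Y \<noteq> {}"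
        using V(1) GY by auto
      then show "large (N \<inter> (V \<inter> \<Union>(\<F> - {D})))"
        using others[of "N \<inter> V"] by (simp add: Int_assoc)
    qed
    have G: "\<F> - {D} \<subset> \<F>"
      using D by auto
    obtain A K where A: "A \<subseteq> \<Union>(\<F> - {D})" "large A" "closedin X K" "A \<subseteq> K" "K \<subseteq> V"
      and lim: "\<forall>B\<subseteq>K \<inter> Y. large B \<longrightarrow> Y \<inter> X derived_set_of B \<noteq> {}"
      and esc: "X derived_set_of A \<inter> \<Union>(\<F> - {D}) = {}"
      by (rule escaping_set[OF G V(1) ne VG_big])
    define F where "F = Y \<inter> X derived_set_of A"
    have FK: "F \<subseteq> K"
      using derived_set_of_subset_closed[OF A(3,4)] by (auto simp: F_def)
    have "Y \<subseteq> D \<union> \<Union>(\<F> - {D})"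
      using partitionD(2) by auto
    then have "F \<subseteq> V \<inter> D"
      using FK A(5) esc by (auto simp: F_def)
    moreover have "\<forall>B\<subseteq>F. large B \<longrightarrow> F \<inter> X derived_set_of B \<noteq> {}"
    proof (intro allI impI)
      fix B assume B: "B \<subseteq> F" "large B"
      \<comment> \<open>In a T1 space limit points of limit points are limit points, so limit points
        of \<open>B\<close> in \<open>Y\<close> belong to \<open>F\<close>.\<close>
      have "X derived_set_of B \<subseteq> X derived_set_of (X derived_set_of A)"
        by (rule derived_set_of_mono) (use B F_def in auto)
      also have "\<dots> \<subseteq> X derived_set_of A"
        using t1_space by (rule derived_set_of_derived_set_subset_gen)
      finally have "X derived_set_of B \<subseteq> X derived_set_of A" .
      moreover have "B \<subseteq> K \<inter> Y"
        using B(1) FK by (auto simp: F_def)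
      ultimately show "F \<inter> X derived_set_of B \<noteq> {}"
        using lim[rule_format, of B] B(2) by (auto simp: F_def)
    qed
    moreover have "A \<subseteq> V \<inter> Y"
      using subset_trans[OF A(1) GY] A(4,5) by auto
    moreover have "\<forall>B\<subseteq>A. large B \<longrightarrow> F \<inter> X derived_set_of B \<noteq> {}"
    proof (intro allI impI)
      fix B assume B: "B \<subseteq> A" "large B"
      then have "B \<subseteq> K \<inter> Y"
        using subset_trans[OF A(1) GY] A(4) by auto
      then show "F \<inter> X derived_set_of B \<noteq> {}"
        using lim[rule_format, of B] B(2) derived_set_of_mono[OF B(1), of X] by (auto simp: F_def)
    qed
    ultimately show ?thesis
      using A(2) *[of F A] by simp
  qed
  then show thesis
    using that by auto
qed

text \<open>By \<open>captured_in_block\<close> the set \<open>M\<close> meets each block inside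
  every open set that meets \<open>Y\<close>. A decisive block therefore lies in \<open>M\<close> on
  some smaller open set, and finitely many shrinkings treat all blocks.\<close>

lemma captured_everywhere:
  obtains V where "openin X V" "V \<inter> Y \<noteq> {}"
    "\<forall>q\<in>V \<inter> Y. \<exists>S P. S \<subseteq> V \<inter> Y \<and> captured S P \<and> acc_point q S"
proof -
  define M where "M = {q \<in> Y. \<exists>S P. S \<subseteq> Y \<and> captured S P \<and> acc_point q S}"
  have meets: "W \<inter> D \<inter> M \<noteq> {}" if D: "D \<in> \<F>" and W: "openin X W" "W \<inter> Y \<noteq> {}" for W D
  proof -
    obtain S P where S: "S \<subseteq> W \<inter> Y" "P \<subseteq> W \<inter> D" "captured S P"
      using captured_in_block[OF D W] .
    then obtain q where q: "q \<in> P" "acc_point q S"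
      using captured_imp_acc_point by metis
    have "q \<in> Y" "S \<subseteq> Y"
      using q(1) S D partitionD(2) by auto
    then have "q \<in> M"
      unfolding M_def using q(2) S(3) by auto
    then show ?thesis
      using q(1) S(2) by auto
  qed
  have "\<exists>V. openin X V \<and> V \<inter> Y \<noteq> {} \<and> V \<inter> \<Union>\<G> \<subseteq> M" if "\<G> \<subseteq> \<F>" for \<G>
    using finite_subset[OF that partitionD(1)] that
  proof (induction \<G> rule: finite_induct)
    case empty
    have "topspace X \<inter> Y \<noteq> {}"
      using Y_props by auto
    then show ?case
      by (intro exI[of _ "topspace X"]) simp
  next
    case (insert D \<G>)
    then obtain V where V: "openin X V" "V \<inter> Y \<noteq> {}" "V \<inter> \<Union>\<G> \<subseteq> M"
      by auto
    have D: "D \<in> \<F>"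
      using insert.prems by simp
    have "V \<inter> D \<noteq> {}"
      using rel_dense_meets[OF partitionD(3)[OF D] V(1,2)] .
    then obtain V' where V': "openin X V'" "V' \<subseteq> V" "V' \<inter> D \<noteq> {}" "V' \<inter> D \<inter> M = {} \<or> V' \<inter> D \<subseteq> M"
      using partitionD(4)[OF D] V(1) unfolding decisive_def by meson
    have "V' \<inter> Y \<noteq> {}"
      using V'(3) D partitionD(2) by auto
    moreover from this have "V' \<inter> D \<subseteq> M"
      using meets[OF D V'(1)] V'(4) by simp
    then have "V' \<inter> \<Union>(insert D \<G>) \<subseteq> M"
      using V(3) V'(2) by auto
    ultimately show ?case
      using V'(1) by (intro exI[of _ V']) simp
  qed
  then obtain V where V: "openin X V" "V \<inter> Y \<noteq> {}" "V \<inter> Y \<subseteq> M"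
    using partitionD(2) by (metis order_refl)
  have "\<exists>S P. S \<subseteq> V \<inter> Y \<and> captured S P \<and> acc_point q S" if q: "q \<in> V \<inter> Y" for q
  proof -
    have "q \<in> M"
      using q V(3) by auto
    then obtain S P where S: "S \<subseteq> Y" "captured S P" "acc_point q S"
      by (auto simp: M_def)
    have qV: "q \<in> V"
      using q by simp
    have "captured (V \<inter> S) P"
      using S(2) _ acc_pointD[OF S(3) V(1) qV] by (rule captured_subset) simp
    then show ?thesis
      using acc_point_open[OF S(3) V(1) qV] S(1) by (intro exI[of _ "V \<inter> S"] exI[of _ P]) auto
  qed
  then show thesis
    using that V(1,2) by simp
qed

text \<open>Closing a point under \<open>q \<mapsto> S q\<close> takes \<omega> steps and keeps the
  size at most \<kappa>. The closure \<open>Q'\<close> contains the union of its captured sets, so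
  every open set that meets this union meets \<open>Q'\<close>, as
  \<open>omega_split_captured_family\<close> requires.\<close>

lemma contradictory: False
proof -
  obtain V where V: "openin X V" "V \<inter> Y \<noteq> {}"
    "\<forall>q\<in>V \<inter> Y. \<exists>S P. S \<subseteq> V \<inter> Y \<and> captured S P \<and> acc_point q S"
    by (rule captured_everywhere)
  from bchoice[OF V(3)] obtain S
    where "\<forall>q\<in>V \<inter> Y. \<exists>P. S q \<subseteq> V \<inter> Y \<and> captured (S q) P \<and> acc_point q (S q)" ..
  from bchoice[OF this] obtain P
    where S: "\<forall>q\<in>V \<inter> Y. S q \<subseteq> V \<inter> Y \<and> captured (S q) (P q) \<and> acc_point q (S q)" ..
  obtain x where x: "x \<in> V \<inter> Y"
    using V(2) by auto
  define Q where "Q n = ((\<lambda>A. \<Union>q\<in>A. S q) ^^ n) {x}" for n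
  have Q: "Q n \<subseteq> V \<inter> Y \<and> moderate (Q n)" for n
  proof (induction n)
    case 0
    then show ?case
      using x by (simp add: Q_def small_imp_moderate countable_imp_small)
  next
    case (Suc n)
    have Suc_Q: "Q (Suc n) = (\<Union>q\<in>Q n. S q)"
      by (simp add: Q_def)
    have "S q \<subseteq> V \<inter> Y" "moderate (S q)" if "q \<in> Q n" for q
      using S Suc that by (auto simp: captured_def)
    then show ?case
      unfolding Suc_Q using Suc moderate_UN[of "Q n" S] by auto
  qed
  define Q' where "Q' = (\<Union>n. Q n)"
  have Q': "Q' \<subseteq> V \<inter> Y" "moderate Q'"
    unfolding Q'_def using Q
    by (auto intro!: moderate_UN simp: small_imp_moderate countable_imp_small)
  have closed: "(\<Union>q\<in>Q'. S q) \<subseteq> Q'"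
  proof
    fix y assume "y \<in> (\<Union>q\<in>Q'. S q)"
    then obtain n q where "q \<in> Q n" "y \<in> S q"
      by (auto simp: Q'_def)
    then have "y \<in> Q (Suc n)"
      by (auto simp: Q_def)
    then show "y \<in> Q'"
      by (auto simp: Q'_def)
  qed
  have "omega_split X (\<Union>q\<in>Q'. S q)"
  proof (rule omega_split_captured_family[OF Q'(2)])
    show "\<forall>q\<in>Q'. captured (S q) (P q) \<and> acc_point q (S q)"
      using S Q'(1) by auto
    show "W \<inter> Q' \<noteq> {}" if "W \<inter> (\<Union>q\<in>Q'. S q) \<noteq> {}" for W
      using closed that by auto
  qed
  moreover have "x \<in> Q'"
    unfolding Q'_def by (rule UN_I[of 0]) (simp_all add: Q_def)
  then have "S x \<noteq> {}" "S x \<subseteq> (\<Union>q\<in>Q'. S q)"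
    using S x captured_nonempty[of "S x" "P x"] by auto
  then have "(\<Union>q\<in>Q'. S q) \<noteq> {}"
    by auto
  moreover have "(\<Union>q\<in>Q'. S q) \<subseteq> Y"
    using closed Q'(1) by auto
  ultimately show False
    using unsplit[of "\<Union>q\<in>Q'. S q"] by simp
qed

end

section \<open>From the least partition to all admissible sets\<close>

context regular_cardinal_space
begin

lemma admissible_omega_split_subset:
  assumes Y: "admissible Y"
  obtains Z where "Z \<subseteq> Y" "Z \<noteq> {}" "omega_split X Z"
proof (rule ccontr)
  note found = that
  assume "\<not> thesis"
  then have no: "\<not> omega_split X Z" if "Z \<subseteq> Y" "Z \<noteq> {}" for Z
    using found that by auto
  \<comment> \<open>The numbers of blocks occurring in any admissible subset of \<open>Y\<close>.
    Shrinking \<open>Y\<close> to an open part shows that there is one.\<close>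
  define Q where "Q n \<longleftrightarrow> (\<exists>Y' \<F>. Y' \<subseteq> Y \<and> admissible Y' \<and> decisive_partition X Y' \<F> \<and> card \<F> = n)" for n
  have "Y \<subseteq> topspace X" "Y \<noteq> {}"
    using Y by (simp_all add: admissible_def)
  then obtain V \<F> where "openin X V" "V \<inter> Y \<noteq> {}" "decisive_partition X (V \<inter> Y) \<F>"
    by (rule decisive_partition_somewhere[rotated]) (use no in auto)
  then have "Q (card \<F>)"
    unfolding Q_def using admissible_open[OF Y] by (intro exI[of _ "V \<inter> Y"] exI[of _ \<F>]) simp
  then have "Q (LEAST n. Q n)"
    by (rule LeastI)
  then obtain Y' \<F>' where Y': "Y' \<subseteq> Y" "admissible Y'" "decisive_partition X Y' \<F>'"
    "card \<F>' = (LEAST n. Q n)"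
    unfolding Q_def by (elim exE conjE)
  interpret minimal_decisive_partition \<kappa> X Y' \<F>'
  proof
    show "card \<F>' \<le> card \<F>''" if "Y'' \<subseteq> Y'" "admissible Y''" "decisive_partition X Y'' \<F>''" for Y'' \<F>''
    proof -
      have "Q (card \<F>'')"
        unfolding Q_def using that Y'(1) by (intro exI[of _ Y''] exI[of _ \<F>'']) auto
      then show ?thesis
        unfolding Y'(4) by (rule Least_le)
    qed
    show "\<not> omega_split X Z" if "Z \<subseteq> Y'" "Z \<noteq> {}" for Z
      using no that Y'(1) by auto
  qed (rule Y')+
  show False
    by (rule contradictory)
qed

lemma admissible_omega_split:
  assumes Y: "admissible Y"
  shows "omega_split X Y"
proof (rule split_into_glue)
  fix W assume "openin X W" "W \<inter> Y \<noteq> {}"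
  then have "admissible (W \<inter> Y)"
    by (rule admissible_open[OF Y])
  then obtain Z where "Z \<subseteq> W \<inter> Y" "Z \<noteq> {}" "omega_split X Z"
    by (rule admissible_omega_split_subset)
  then show "\<exists>Z. omega_split X Z \<and> Z \<noteq> {} \<and> Z \<subseteq> W \<inter> Y"
    by auto
qed

end

section \<open>Dispersion character and extent\<close>

lemma resolvable_natLeq:
  assumes "topspace X \<noteq> {}" "omega_split X (topspace X)"
  shows "resolvable natLeq X"
proof -
  obtain C :: "nat \<Rightarrow> 'a set" where C: "disjoint_family C" "\<forall>i. rel_dense X (C i) (topspace X)"
    using assms(2) unfolding split_into_def by auto
  \<comment> \<open>Nonempty parts make \<open>C\<close> injective; \<open>resolvable\<close> counts
    the members of a set of dense sets, not indices.\<close>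
  have ne: "C i \<noteq> {}" for i
    using rel_dense_meets[OF C(2)[rule_format, of i] openin_topspace] assms(1) by auto
  have "inj C"
  proof (rule injI, rule ccontr)
    fix i j assume "C i = C j" "i \<noteq> j"
    then show False
      using disjoint_family_onD[OF C(1), of i j] ne[of j] by simp
  qed
  then have "|range C| =o natLeq"
    using card_of_ordIsoI[of C UNIV "range C"] card_of_nat ordIso_symmetric ordIso_transitive
    by (metis inj_on_imp_bij_betw)
  moreover have "disjoint (range C)"
    using C(1) by (rule disjoint_family_on_disjoint_image)
  moreover have "dense_in X (C i)" for i
  proof -
    have "C i \<subseteq> topspace X"
      using C(2) rel_dense_subset by metis
    moreover have "C i \<inter> T \<noteq> {}" if "openin X T" "T \<noteq> {}" for T
      using rel_dense_meets[OF C(2)[rule_format, of i] that(1)] that openin_subset[OF that(1)]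
      by auto
    ultimately show ?thesis
      by (simp add: dense_in_def dense_intersects_open)
  qed
  ultimately show ?thesis
    unfolding resolvable_def by (intro exI[of _ "range C"]) auto
qed

lemma closed_discreteI:
  "C \<subseteq> topspace X \<Longrightarrow> X derived_set_of C = {} \<Longrightarrow> closed_discrete X C"
  by (simp add: closed_discrete_def closedin_contains_derived_set subtopology_eq_discrete_topology_eq)

text \<open>A large set without limit points would be closed and discrete, which the bound on
  \<open>extent_hat\<close> excludes. So the whole space is admissible.\<close>

lemma (in regular_cardinal_space) resolvable:
  assumes ne: "topspace X \<noteq> {}"
    and disp: "\<kappa> \<le>o dispersion_character X" and ext: "extent_hat X \<le>o \<kappa>"
  shows "resolvable natLeq X"
proof -
  have "big (topspace X)"
    unfolding big_def
  proof (intro allI impI)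
    fix W assume "openin X W" "W \<inter> topspace X \<noteq> {}"
    then have "\<kappa> \<le>o |W|" "W \<inter> topspace X = W"
      using disp openin_subset[of X W] unfolding dispersion_character_ge_iff[OF ne] by auto
    then show "large (W \<inter> topspace X)"
      by (simp add: large_iff)
  qed
  moreover have "topspace X \<inter> X derived_set_of A \<noteq> {}" if A: "A \<subseteq> topspace X" "large A" for A
  proof
    assume "topspace X \<inter> X derived_set_of A = {}"
    then have "closed_discrete X A"
      using derived_set_of_subset_topspace[of X A] by (intro closed_discreteI A(1)) auto
    then show False
      using ext A(2) unfolding extent_hat_le_iff[OF card_order] by (simp add: small_def)
  qed
  ultimately have "admissible (topspace X)"
    unfolding admissible_def using ne by (auto intro!: exI[of _ "topspace X"])
  then show ?thesis
    by (intro resolvable_natLeq ne admissible_omega_split)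
qed

section \<open>Spaces whose dispersion character exceeds the extent\<close>

lemma Card_order_extent: "Card_order (extent X)"
  unfolding extent_def least_card_def by (rule card_of_Card_order)

lemma Card_order_dispersion_character: "Card_order (dispersion_character X)"
  unfolding dispersion_character_def least_card_def by (rule card_of_Card_order)

lemma closed_discrete_le_extent: "closed_discrete X C \<Longrightarrow> |C| \<le>o extent X"
  using extent_le_iff[OF Card_order_extent, of X X] ordLeq_reflexive[of "extent X"]
    Card_order_extent[of X] by (simp add: card_order_on_well_order_on)

text \<open>This makes the successor of the extent uncountable and regular. Finite sets in a T1
  space are closed and discrete, so a finite extent forces a finite space. That space is itself
  closed and discrete, and its dispersion character cannot exceed its extent.\<close>

lemma natLeq_le_extent:
  assumes ne: "topspace X \<noteq> {}" and "t1_space X" and less: "extent X <o dispersion_character X"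
  shows "natLeq \<le>o extent X"
proof -
  obtain A :: "'a set" where A: "extent X = |A|"
    unfolding extent_def least_card_def by auto
  have fin: "|B| \<le>o |A|" if "finite B" "B \<subseteq> topspace X" for B
  proof -
    have "closed_discrete X B"
      using that assms(2) by (intro closed_discreteI) (auto simp: t1_space_derived_set_of_finite)
    then show ?thesis
      using closed_discrete_le_extent A by metis
  qed
  have "infinite A"
  proof
    assume "finite A"
    show False
    proof (cases "finite (topspace X)")
      case True
      then have "|topspace X| \<le>o extent X"
        unfolding A by (intro fin) auto
      moreover have "dispersion_character X \<le>o |topspace X|"
        using dispersion_character_ge_iff[OF ne, of "dispersion_character X"]
          ordLeq_reflexive[of "dispersion_character X"] ne
          Card_order_dispersion_character[of X] by (simp add: card_order_on_well_order_on)
      ultimately show False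
        using less ordLess_ordLeq_trans not_ordLess_ordLeq by metis
    next
      case False
      obtain B where B: "finite B" "card B = Suc (card A)" "B \<subseteq> topspace X"
        using infinite_arbitrarily_large[OF False, of "Suc (card A)"] by metis
      then have "card B \<le> card A"
        using fin[OF B(1,3)] \<open>finite A\<close> card_inj_on_le unfolding card_of_ordLeq[symmetric] by metis
      then show False
        using B(2) by simp
    qed
  qed
  then show ?thesis
    using A infinite_iff_natLeq_ordLeq by metis
qed

theorem theorem3p1:
  shows "(\<forall>\<kappa> :: 'k rel. Card_order \<kappa> \<and> natLeq <o \<kappa> \<and> regularCard \<kappa> \<longrightarrow>
            (\<forall>X :: 'a topology. topspace X \<noteq> {} \<and> regular_space X \<and> t1_space X \<and>
               \<kappa> \<le>o dispersion_character X \<and> extent_hat X \<le>o \<kappa> \<longrightarrow>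
               resolvable natLeq X)) \<and>
         (\<forall>X :: 'b topology. topspace X \<noteq> {} \<and> regular_space X \<and> t1_space X \<and>
            extent X <o dispersion_character X \<longrightarrow>
            resolvable natLeq X)"
proof (intro conjI allI impI; elim conjE)
  fix \<kappa> :: "'k rel" and X :: "'a topology"
  assume \<kappa>: "Card_order \<kappa>" "natLeq <o \<kappa>" "regularCard \<kappa>"
    and X: "topspace X \<noteq> {}" "regular_space X" "t1_space X"
      "\<kappa> \<le>o dispersion_character X" "extent_hat X \<le>o \<kappa>"
  interpret regular_cardinal_space \<kappa> X
    by unfold_locales (rule \<kappa> X)+
  show "resolvable natLeq X"
    by (rule resolvable) (rule X)+
next
  fix X :: "'b topology"
  assume X: "topspace X \<noteq> {}" "regular_space X" "t1_space X"
    and less: "extent X <o dispersion_character X"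
  \<comment> \<open>Successors of infinite cardinals are regular, and closed discrete sets, bounded
    by the extent, are smaller than its successor.\<close>
  let ?\<kappa> = "cardSuc (extent X)"
  have inf: "natLeq \<le>o extent X"
    using X(1,3) less by (rule natLeq_le_extent)
  then have "Cinfinite (extent X)"
    using natLeq_cinfinite cinfinite_mono Card_order_extent by metis
  then have regular: "regularCard ?\<kappa>"
    by (rule regularCard_cardSuc)
  have unc: "natLeq <o ?\<kappa>"
    using inf cardSuc_greater[OF Card_order_extent] by (rule ordLeq_ordLess_trans)
  interpret regular_cardinal_space ?\<kappa> X
    by unfold_locales (rule cardSuc_Card_order[OF Card_order_extent] unc regular X)+
  have "?\<kappa> \<le>o dispersion_character X"
    using less cardSuc_ordLess_ordLeq[of "extent X" "dispersion_character X"]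
      Card_order_extent[of X] Card_order_dispersion_character[of X] by simp
  moreover have "extent_hat X \<le>o ?\<kappa>"
    unfolding extent_hat_le_iff[OF card_order]
    using closed_discrete_le_extent[of X] cardSuc_ordLeq_ordLess[OF Card_order_extent card_of_Card_order]
    by auto
  ultimately show "resolvable natLeq X"
    using X(1) by (intro resolvable)
qed

end
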